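(* For $a\in\mathcal{R}$ let $[a]=\{b\in\mathcal{R}\mid fb\in\mathcal{R}a\text{ for some }f\in\mathcal{M}\setminus\{0\}\}$. Then: (1) for every $a\in\mathcal{R}$, $[a]$ is a left ideal of $\mathcal{R}$; (2) for every left ideal $I$ of $\mathcal{R}$ there exists $a\in I$ with $\mathcal{R}a\subset I\subset[a]$; (3) for every $\phi\in H$ there exists $a\in\mathcal{R}$ with $\mathrm{ann}_{\mathcal{R}}(\phi)=[a]$.
   Context: Let $\mathrm{Hol}$ be the space of holomorphic functions on the upper half plane, $f'=\frac{1}{2\pi i}\frac{df}{dz}$, $E_2,E_4,E_6$ the Eisenstein series with constant term $1$, and $D_kf=f'-\frac{k}{12}E_2f$. Let $H=\bigoplus_{n\in\mathbb{R}}H_n$ with each $H_n$ a copy of $\mathrm{Hol}$, elements written $(f,n)$, with product $(f,n)(g,m)=(fg,n+m)$. Define $\delta(f,n)=(D_nf,n+2)$, $e_4(f,n)=(E_4f,n+4)$, $e_6(f,n)=(E_6f,n+6)$; $\mathcal{R}$ is the $\mathbb{C}$-algebra of linear operators on $H$ generated by $\delta,e_4,e_6$, and $H$ is a left $\mathcal{R}$-module. $\mathcal{M}=\mathbb{C}[E_4,E_6]$ (level-one holomorphic modular forms, not necessarily homogeneous elements) is identified with the subalgebra of $\mathcal{R}$ generated by $e_4,e_6$. $\mathrm{ann}_{\mathcal{R}}(\phi)=\{a\in\mathcal{R}\mid a\phi=0\}$. *)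

theory Defs
  imports "HOL-Complex_Analysis.Complex_Analysis" "HOL-Library.FuncSet"
begin

definition UHP :: "complex set" where
  "UHP = {z. Im z > 0}"

definition divsum :: "nat \<Rightarrow> nat \<Rightarrow> nat" where
  "divsum k n = (\<Sum>d\<in>{d. d dvd n}. d ^ k)"

definition qpar :: "complex \<Rightarrow> complex" where
  "qpar z = exp (2 * pi * \<i> * z)"

definition E2 :: "complex \<Rightarrow> complex" where
  "E2 z = 1 - 24 * (\<Sum>n. of_nat (divsum 1 (Suc n)) * qpar z ^ Suc n)"

definition E4 :: "complex \<Rightarrow> complex" where
  "E4 z = 1 + 240 * (\<Sum>n. of_nat (divsum 3 (Suc n)) * qpar z ^ Suc n)"

definition E6 :: "complex \<Rightarrow> complex" where
  "E6 z = 1 - 504 * (\<Sum>n. of_nat (divsum 5 (Suc n)) * qpar z ^ Suc n)"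

definition nderiv :: "(complex \<Rightarrow> complex) \<Rightarrow> complex \<Rightarrow> complex" where
  "nderiv f z = deriv f z / (2 * pi * \<i>)"

definition serre :: "real \<Rightarrow> (complex \<Rightarrow> complex) \<Rightarrow> complex \<Rightarrow> complex" where
  "serre k f z = nderiv f z - of_real k / 12 * E2 z * f z"

text \<open>An element of H = direct sum over n in R of copies of Hol is a function
  assigning to each weight n a holomorphic function on the upper half plane
  (normalised to be 0 off the upper half plane), with only finitely many
  nonzero components.  The pair (f,n) corresponds to the element with f at n.\<close>

type_synonym hel = "real \<Rightarrow> complex \<Rightarrow> complex"

definition Hset :: "hel set" where
  "Hset = {\<phi>. finite {n. \<phi> n \<noteq> (\<lambda>_. 0)} \<and>
               (\<forall>n. \<phi> n holomorphic_on UHP) \<and>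
               (\<forall>n z. z \<notin> UHP \<longrightarrow> \<phi> n z = 0)}"

definition hzero :: hel where
  "hzero = (\<lambda>n z. 0)"

type_synonym hop = "hel \<Rightarrow> hel"

text \<open>Operators on H are represented extensionally (restricted to Hset), so that
  equality of operators is equality as maps on H.\<close>

definition delta :: hop where
  "delta = restrict (\<lambda>\<phi> m z. if z \<in> UHP then serre (m - 2) (\<phi> (m - 2)) z else 0) Hset"

definition e4op :: hop where
  "e4op = restrict (\<lambda>\<phi> m z. E4 z * \<phi> (m - 4) z) Hset"

definition e6op :: hop where
  "e6op = restrict (\<lambda>\<phi> m z. E6 z * \<phi> (m - 6) z) Hset"

definition scalop :: "complex \<Rightarrow> hop" where
  "scalop c = restrict (\<lambda>\<phi> m z. c * \<phi> m z) Hset"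

definition opadd :: "hop \<Rightarrow> hop \<Rightarrow> hop" where
  "opadd a b = restrict (\<lambda>\<phi> m z. a \<phi> m z + b \<phi> m z) Hset"

definition opmult :: "hop \<Rightarrow> hop \<Rightarrow> hop" where
  "opmult a b = restrict (a \<circ> b) Hset"

definition opzero :: hop where
  "opzero = restrict (\<lambda>\<phi>. hzero) Hset"

inductive_set Ralg :: "hop set" where
  scal: "scalop c \<in> Ralg"
| del: "delta \<in> Ralg"
| e4: "e4op \<in> Ralg"
| e6: "e6op \<in> Ralg"
| add: "a \<in> Ralg \<Longrightarrow> b \<in> Ralg \<Longrightarrow> opadd a b \<in> Ralg"
| mult: "a \<in> Ralg \<Longrightarrow> b \<in> Ralg \<Longrightarrow> opmult a b \<in> Ralg"

text \<open>M = C[E4,E6], identified with the subalgebra of R generated by e4, e6.\<close>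
inductive_set Malg :: "hop set" where
  scal: "scalop c \<in> Malg"
| e4: "e4op \<in> Malg"
| e6: "e6op \<in> Malg"
| add: "a \<in> Malg \<Longrightarrow> b \<in> Malg \<Longrightarrow> opadd a b \<in> Malg"
| mult: "a \<in> Malg \<Longrightarrow> b \<in> Malg \<Longrightarrow> opmult a b \<in> Malg"

definition left_ideal :: "hop set \<Rightarrow> bool" where
  "left_ideal I \<longleftrightarrow> I \<subseteq> Ralg \<and> opzero \<in> I \<and>
     (\<forall>a\<in>I. \<forall>b\<in>I. opadd a b \<in> I) \<and>
     (\<forall>r\<in>Ralg. \<forall>a\<in>I. opmult r a \<in> I)"

definition Rmul :: "hop \<Rightarrow> hop set" where
  "Rmul a = {opmult r a | r. r \<in> Ralg}"

definition closure_ideal :: "hop \<Rightarrow> hop set" where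
  "closure_ideal a = {b \<in> Ralg. \<exists>f\<in>Malg. f \<noteq> opzero \<and> opmult f b \<in> Rmul a}"

definition ann :: "hel \<Rightarrow> hop set" where
  "ann \<phi> = {a \<in> Ralg. a \<phi> = hzero}"

end

theory Submission
  imports Defs
begin

text \<open>
  By the Leibniz rule \<open>\<delta> f - f \<delta>\<close> is again multiplication by an element of \<open>M\<close>, because Ramanujan's
  identities give \<open>D\<^sub>4 E\<^sub>4 = - E\<^sub>6 / 3\<close> and \<open>D\<^sub>6 E\<^sub>6 = - E\<^sub>4\<^sup>2 / 2\<close>. Hence \<open>R\<close> consists of the sums
  of the \<open>f\<^sub>i \<delta>\<^sup>i\<close> with \<open>f\<^sub>i\<close> in \<open>M\<close>. Part (1) follows from
  \<open>f\<^sup>2 \<delta> b = f \<delta> (f b) - f' (f b)\<close> with \<open>f' = \<delta> f - f \<delta>\<close>; part (2) is pseudo-division by an element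
  of \<open>I\<close> of minimal order in \<open>\<delta>\<close>; part (3) applies (2) to the annihilator, using that \<open>H\<close> is
  torsion-free over \<open>M\<close>.

  Ramanujan's identities are equivalent to evaluations of convolution sums of divisor functions.
  These are obtained from an involution on the solutions of \<open>a x + b y = n\<close> with \<open>a > b\<close>.
\<close>

section \<open>Convolution sums of divisor functions\<close>

text \<open>On \<open>q\<close>-expansions the normalised derivative is \<open>X d/dX\<close>, so
  each Ramanujan identity says that a term \<open>n * sigma_k(n)\<close> equals a combination of
  divisor sums and their convolutions. The one for \<open>E6\<close> mixes two convolutions,
  \<open>sigma_1\<close> with \<open>sigma_5\<close> and \<open>sigma_3\<close> with itself; a third
  evaluation, which amounts to \<open>E4^2 = E8\<close>, is there to eliminate
  \<open>sigma_7\<close>. Operators are bare functions on \<open>Hset\<close> and carry no ring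
  structure. The additive endomorphisms of H are therefore made into a type of class
  \<open>ring_1\<close>, and the argument on left ideals is carried out in a locale about two
  subsets of an arbitrary ring. Elements of M need not be homogeneous, so torsion-freeness is not
  just the identity theorem: it compares components of top weight and applies the identity theorem
  to these. It also shows that M has no zero divisors, which keeps products of denominators nonzero
  in every argument about saturations.\<close>

definition reps :: "nat \<Rightarrow> (nat \<times> nat \<times> nat \<times> nat) set" where
  "reps n = {(a, b, x, y). 0 < a \<and> 0 < b \<and> 0 < x \<and> 0 < y \<and> a * x + b * y = n}"

lemma reps_bound:
  assumes "(a, b, x, y) \<in> reps n"
  shows "a \<le> n" "b \<le> n" "x \<le> n" "y \<le> n"
proof -
  have h: "0 < a" "0 < b" "0 < x" "0 < y" "a * x + b * y = n"
    using assms by (auto simp: reps_def)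
  have "a * 1 \<le> a * x" "1 * x \<le> a * x" "b * 1 \<le> b * y" "1 * y \<le> b * y"
    using h by (intro mult_le_mono; simp)+
  then show "a \<le> n" "b \<le> n" "x \<le> n" "y \<le> n" using h(5) by linarith+
qed

lemma finite_reps [simp]: "finite (reps n)"
proof (rule finite_subset)
  show "reps n \<subseteq> {..n} \<times> {..n} \<times> {..n} \<times> {..n}"
    using reps_bound by auto
qed simp

lemma sum_reps_transpose:
  "(\<Sum>(a, b, x, y)\<in>reps n. f x y) = (\<Sum>(a, b, x, y)\<in>reps n. f a b)"
  by (rule sum.reindex_bij_witness[where i = "\<lambda>(a, b, x, y). (x, y, a, b)"
        and j = "\<lambda>(a, b, x, y). (x, y, a, b)"])
     (auto simp: reps_def mult.commute)

definition reps_gt :: "nat \<Rightarrow> (nat \<times> nat \<times> nat \<times> nat) set" where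
  "reps_gt n = {(a, b, x, y)\<in>reps n. b < a}"

definition reps_eq :: "nat \<Rightarrow> (nat \<times> nat \<times> nat \<times> nat) set" where
  "reps_eq n = {(a, b, x, y)\<in>reps n. a = b}"

lemma finite_reps_gt [simp]: "finite (reps_gt n)"
  and finite_reps_eq [simp]: "finite (reps_eq n)"
  by (auto intro: finite_subset[OF _ finite_reps] simp: reps_gt_def reps_eq_def)

lemma sum_reps_symmetric:
  fixes F :: "nat \<Rightarrow> nat \<Rightarrow> nat \<Rightarrow> nat \<Rightarrow> 'a::comm_ring_1"
  assumes sym: "\<And>a b x y. F a b x y = F b a y x"
  shows "(\<Sum>(a, b, x, y)\<in>reps n. F a b x y) =
    2 * (\<Sum>(a, b, x, y)\<in>reps_gt n. F a b x y) + (\<Sum>(a, b, x, y)\<in>reps_eq n. F a b x y)"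
proof -
  let ?lt = "{(a, b, x, y)\<in>reps n. a < b}"
  have fin: "finite ?lt" by (rule finite_subset[OF _ finite_reps]) auto
  have "(\<Sum>(a, b, x, y)\<in>?lt. F a b x y) = (\<Sum>(a, b, x, y)\<in>reps_gt n. F a b x y)"
    by (rule sum.reindex_bij_witness[where i = "\<lambda>(a, b, x, y). (b, a, y, x)"
          and j = "\<lambda>(a, b, x, y). (b, a, y, x)"])
       (auto simp: reps_gt_def reps_def add.commute intro: sym)
  moreover have "reps n = (reps_gt n \<union> ?lt) \<union> reps_eq n"
    by (auto simp: reps_gt_def reps_eq_def)
  then have "(\<Sum>(a, b, x, y)\<in>reps n. F a b x y) =
      (\<Sum>(a, b, x, y)\<in>(reps_gt n \<union> ?lt) \<union> reps_eq n. F a b x y)"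
    by (rule sum.cong) simp
  moreover have "\<dots> = (\<Sum>(a, b, x, y)\<in>reps_gt n \<union> ?lt. F a b x y)
      + (\<Sum>(a, b, x, y)\<in>reps_eq n. F a b x y)"
    using fin finite_reps_gt[of n] finite_reps_eq[of n]
    by (intro sum.union_disjoint) (auto simp: reps_gt_def reps_eq_def)
  moreover have "(\<Sum>(a, b, x, y)\<in>reps_gt n \<union> ?lt. F a b x y) =
      (\<Sum>(a, b, x, y)\<in>reps_gt n. F a b x y) + (\<Sum>(a, b, x, y)\<in>?lt. F a b x y)"
    using fin finite_reps_gt[of n] by (intro sum.union_disjoint) (auto simp: reps_gt_def)
  ultimately show ?thesis by simp
qed

text \<open>The map \<open>(a, b, x, y) \<mapsto> (x + y, x, b, a - b)\<close> is an involution of \<open>reps_gt n\<close>,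
  because \<open>a * x + b * y = (a - b) * x + b * (x + y)\<close>.\<close>

lemma sum_reps_gt_involution:
  "(\<Sum>(a, b, x, y)\<in>reps_gt n. F a b x y) =
   (\<Sum>(a, b, x, y)\<in>reps_gt n. F (x + y) x b (a - b))"
proof -
  have inv: "(x + y, x, b, a - b) \<in> reps_gt n" if "(a, b, x, y) \<in> reps_gt n" for a b x y
  proof -
    from that have "b < a" by (simp add: reps_gt_def)
    then obtain c where c: "a = b + c" by (metis less_imp_le_nat le_iff_add)
    with that show ?thesis by (auto simp: reps_gt_def reps_def algebra_simps)
  qed
  show ?thesis
    by (rule sum.reindex_bij_witness[where i = "\<lambda>(a, b, x, y). (x + y, x, b, a - b)"
          and j = "\<lambda>(a, b, x, y). (x + y, x, b, a - b)"])
       (use inv in \<open>auto simp: reps_gt_def\<close>)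
qed

text \<open>On the diagonal the equation reads \<open>a * (x + y) = n\<close>: the divisor is
  \<open>d = x + y\<close>, its cofactor is \<open>a\<close>, and \<open>x\<close> stops before
  \<open>d\<close> because \<open>y\<close> is positive.\<close>

lemma sum_reps_eq:
  assumes "0 < n"
  shows "(\<Sum>(a, b, x, y)\<in>reps_eq n. F a x y) = (\<Sum>d | d dvd n. \<Sum>x=1..<d. F (n div d) x (d - x))"
proof -
  have fin: "finite {d. d dvd n}" using assms by simp
  have "(\<Sum>d | d dvd n. \<Sum>x=1..<d. F (n div d) x (d - x)) =
        (\<Sum>(d, x)\<in>(SIGMA d:{d. d dvd n}. {1..<d}). F (n div d) x (d - x))"
    by (rule sum.Sigma) (use fin in auto)
  also have "\<dots> = (\<Sum>(a, b, x, y)\<in>reps_eq n. F a x y)"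
  proof (rule sum.reindex_bij_witness[where j = "\<lambda>(d, x). (n div d, n div d, x, d - x)"
        and i = "\<lambda>(a, b, x, y). (x + y, x)"], goal_cases)
    case (2 v)
    obtain d x where v: "v = (d, x)" by (cases v)
    from 2 v have d: "d dvd n" "1 \<le> x" "x < d" by auto
    have "n div d * x + n div d * (d - x) = n div d * d"
      using d by (simp add: add_mult_distrib2 [symmetric])
    with d assms show ?case unfolding v
      by (auto simp: reps_eq_def reps_def div_greater_zero_iff dvd_imp_le)
  next
    case (4 v)
    then show ?case by (auto simp: reps_eq_def reps_def simp flip: add_mult_distrib2)
  next
    case (3 v)
    have "a * x + a * y = n \<Longrightarrow> 0 < x \<Longrightarrow> n div (x + y) = a" for a x y
      by (auto simp flip: add_mult_distrib2)
    with 3 show ?case by (auto simp: reps_eq_def reps_def)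
  next
    case (5 v)
    have "a * x + a * y = n \<Longrightarrow> 0 < x \<Longrightarrow> n div (x + y) = a" for a x y
      by (auto simp flip: add_mult_distrib2)
    with 5 show ?case by (auto simp: reps_eq_def reps_def)
  qed auto
  finally show ?thesis ..
qed

text \<open>Exchanging \<open>(a, b)\<close> with \<open>(x, y)\<close> replaces
  \<open>p a b\<close> by \<open>p x y\<close>. The new summand is symmetric, so the sum is twice
  the part with \<open>a > b\<close> plus the diagonal. On the part with \<open>a > b\<close> the
  involution turns \<open>p x y\<close> into \<open>p b (a - b)\<close>, so everything cancels there
  and only the diagonal survives.\<close>

lemma sum_reps_reduction:
  fixes p :: "'a::comm_ring_1 \<Rightarrow> 'a \<Rightarrow> 'a"
  assumes n: "0 < n"
    and sym: "\<And>x y. p x y = p y x"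
    and sym': "\<And>a b. p b (a - b) = p a (b - a)"
  shows "(\<Sum>(a, b, x, y)\<in>reps n. p (of_nat a) (of_nat b) - p (of_nat b) (of_nat a - of_nat b)) =
    (\<Sum>d | d dvd n. \<Sum>x=1..<d. p (of_nat x) (of_nat d - of_nat x) - p (of_nat (n div d)) 0)"
proof -
  let ?F = "\<lambda>a b x y. p (of_nat x) (of_nat y) - p (of_nat b) (of_nat a - of_nat b) :: 'a"
  have "(\<Sum>(a, b, x, y)\<in>reps_gt n. p (of_nat x) (of_nat y)) =
        (\<Sum>(a, b, x, y)\<in>reps_gt n. p (of_nat b) (of_nat (a - b)))"
    by (subst sum_reps_gt_involution) simp
  also have "\<dots> = (\<Sum>(a, b, x, y)\<in>reps_gt n. p (of_nat b) (of_nat a - of_nat b))"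
    by (rule sum.cong) (auto simp: reps_gt_def of_nat_diff)
  finally have gt: "(\<Sum>(a, b, x, y)\<in>reps_gt n. ?F a b x y) = 0"
    by (simp add: sum_subtractf split_def)
  have "(\<Sum>(a, b, x, y)\<in>reps n. p (of_nat a) (of_nat b) - p (of_nat b) (of_nat a - of_nat b)) =
        (\<Sum>(a, b, x, y)\<in>reps n. ?F a b x y)"
    using sum_reps_transpose[of "\<lambda>x y. p (of_nat x) (of_nat y)" n]
    by (simp add: sum_subtractf split_def)
  also have "\<dots> = (\<Sum>(a, b, x, y)\<in>reps_eq n. ?F a b x y)"
    by (subst sum_reps_symmetric[of ?F n], subst sym, subst sym', rule refl) (simp only: gt, simp)
  also have "\<dots> = (\<Sum>(a, b, x, y)\<in>reps_eq n. p (of_nat x) (of_nat y) - p (of_nat a) 0)"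
    by (rule sum.cong) (auto simp: reps_eq_def)
  also have "\<dots> = (\<Sum>d | d dvd n. \<Sum>x=1..<d. p (of_nat x) (of_nat (d - x)) - p (of_nat (n div d)) 0)"
    by (rule sum_reps_eq[OF n])
  also have "\<dots> = (\<Sum>d | d dvd n. \<Sum>x=1..<d. p (of_nat x) (of_nat d - of_nat x) - p (of_nat (n div d)) 0)"
    by (intro sum.cong refl) (auto simp: of_nat_diff)
  finally show ?thesis .
qed

definition divconv :: "nat \<Rightarrow> nat \<Rightarrow> nat \<Rightarrow> nat" where
  "divconv i j n = (\<Sum>k=1..<n. divsum i k * divsum j (n - k))"

text \<open>Group the solutions by \<open>k = a * x\<close>: then \<open>a\<close> runs through the
  divisors of \<open>k\<close> and \<open>b\<close> through those of \<open>n - k\<close>.\<close>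

lemma sum_reps_powers:
  "(\<Sum>(a, b, x, y)\<in>reps n. of_nat a ^ i * of_nat b ^ j) = (of_nat (divconv i j n) :: 'a::comm_ring_1)"
proof -
  have pos: "0 < k div a \<and> 0 < a" if "a dvd k" "0 < k" for a k :: nat
    using that by (auto elim!: dvdE)
  let ?A = "SIGMA k:{1..<n}. {a. a dvd k} \<times> {b. b dvd n - k}"
  have "of_nat (divconv i j n) = (\<Sum>k=1..<n. \<Sum>(a, b)\<in>{a. a dvd k} \<times> {b. b dvd n - k}. (of_nat a ^ i * of_nat b ^ j :: 'a))"
    by (simp add: divconv_def divsum_def sum_product sum.cartesian_product split_def)
  also have "\<dots> = (\<Sum>(k, a, b)\<in>?A. of_nat a ^ i * of_nat b ^ j)"
    by (subst sum.Sigma) auto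
  also have "\<dots> = (\<Sum>(a, b, x, y)\<in>reps n. of_nat a ^ i * of_nat b ^ j)"
  proof (rule sum.reindex_bij_witness[where j = "\<lambda>(k, a, b). (a, b, k div a, (n - k) div b)"
          and i = "\<lambda>(a, b, x, y). (a * x, a, b)"], goal_cases)
    case (2 v)
    obtain k a b where v: "v = (k, a, b)" by (cases v)
    with 2 have h: "a dvd k" "0 < k" "b dvd n - k" "0 < n - k" by auto
    then show ?case using pos[OF h(1,2)] pos[OF h(3,4)] by (auto simp: v reps_def)
  qed (auto simp: reps_def)
  finally show ?thesis ..
qed

lemma divconv_commute:
  "divconv i j n = divconv j i n"
  unfolding divconv_def
  by (rule sum.reindex_bij_witness[where i = "\<lambda>k. n - k" and j = "\<lambda>k. n - k"]) (auto simp: mult.commute)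

lemma sum_divisors_flip:
  assumes "0 < n"
  shows "(\<Sum>d | d dvd n. f (n div d)) = (\<Sum>d | d dvd (n::nat). f d)"
proof -
  have "n div d dvd n \<and> n div (n div d) = d" if "d dvd n" for d
    using that assms by (auto elim!: dvdE)
  then show ?thesis
    by (intro sum.reindex_bij_witness[where i = "\<lambda>d. n div d" and j = "\<lambda>d. n div d"]) auto
qed

text \<open>The symmetry conditions of \<open>sum_reps_reduction\<close> hold for \<open>x\<^sup>2 + x y + y\<^sup>2\<close> and \<open>(x y (x + y))\<^sup>2\<close>, and the
  difference \<open>p a b - p b (a - b)\<close> is then odd in \<open>a\<close> and in \<open>b\<close>: hence the choice of \<open>p\<close> in the
  three evaluations below.\<close>

lemma sum_powers_lessThan:
  fixes m :: nat
  assumes "0 < m"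
  defines "c \<equiv> of_nat m :: 'a::field_char_0"
  shows "(\<Sum>x=1..<m. 1 :: 'a) = c - 1"
    and "(\<Sum>x=1..<m. of_nat x :: 'a) = c^2/2 - c/2"
    and "(\<Sum>x=1..<m. of_nat x ^ 2 :: 'a) = c^3/3 - c^2/2 + c/6"
    and "(\<Sum>x=1..<m. of_nat x ^ 3 :: 'a) = c^4/4 - c^3/2 + c^2/4"
    and "(\<Sum>x=1..<m. of_nat x ^ 4 :: 'a) = c^5/5 - c^4/2 + c^3/3 - c/30"
    and "(\<Sum>x=1..<m. of_nat x ^ 5 :: 'a) = c^6/6 - c^5/2 + 5*c^4/12 - c^2/12"
    and "(\<Sum>x=1..<m. of_nat x ^ 6 :: 'a) = c^7/7 - c^6/2 + c^5/2 - c^3/6 + c/42"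
  unfolding c_def using assms(1)
  by (induction m rule: nat_induct_non_zero; simp; simp add: field_simps power_numeral_reduce)+

text \<open>With \<open>y = c - x\<close> the form \<open>x^2 + x y + y^2\<close> becomes
  \<open>x^2 - c x + c^2\<close>. The constant \<open>a\<close> stands for
  \<open>p (n div d) 0\<close>, which is subtracted once for each of the \<open>c - 1\<close> values
  of \<open>x\<close>.\<close>

lemma sum_norm_form_2:
  fixes a :: "'a::field_char_0"
  assumes "0 < m"
  defines "c \<equiv> of_nat m"
  shows "(\<Sum>x=1..<m. (of_nat x ^ 2 + of_nat x * (c - of_nat x) + (c - of_nat x) ^ 2) ^ 2 - a) =
    7/10*c^5 - c^4 + c^3/3 - c/30 - (c - 1) * a"
proof -
  have "(\<Sum>x=1..<m. (of_nat x ^ 2 + of_nat x * (c - of_nat x) + (c - of_nat x) ^ 2) ^ 2 - a) =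
    (\<Sum>x=1..<m. of_nat x ^ 4 - 2*c * of_nat x ^ 3 + 3*c^2 * of_nat x ^ 2 - 2*c^3 * of_nat x + (c^4 - a) * 1)"
    by (rule sum.cong) (auto simp: algebra_simps power_numeral_reduce)
  also have "\<dots> = (c^5/5 - c^4/2 + c^3/3 - c/30) - 2*c * (c^4/4 - c^3/2 + c^2/4)
     + 3*c^2 * (c^3/3 - c^2/2 + c/6) - 2*c^3 * (c^2/2 - c/2) + (c^4 - a) * (c - 1)"
    unfolding sum.distrib sum_subtractf sum_distrib_left [symmetric]
    using sum_powers_lessThan[OF assms(1), where 'a='a] by (simp only: c_def)
  also have "\<dots> = 7/10*c^5 - c^4 + c^3/3 - c/30 - (c - 1) * a"
    by (simp add: field_simps power_numeral_reduce)
  finally show ?thesis .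
qed

lemma sum_norm_form_3:
  fixes a :: "'a::field_char_0"
  assumes "0 < m"
  defines "c \<equiv> of_nat m"
  shows "(\<Sum>x=1..<m. (of_nat x ^ 2 + of_nat x * (c - of_nat x) + (c - of_nat x) ^ 2) ^ 3 - a) =
    83/140*c^7 - c^6 + c^5/2 - 7/60*c^3 + c/42 - (c - 1) * a"
proof -
  have "(\<Sum>x=1..<m. (of_nat x ^ 2 + of_nat x * (c - of_nat x) + (c - of_nat x) ^ 2) ^ 3 - a) =
    (\<Sum>x=1..<m. of_nat x ^ 6 - 3*c * of_nat x ^ 5 + 6*c^2 * of_nat x ^ 4 - 7*c^3 * of_nat x ^ 3
       + 6*c^4 * of_nat x ^ 2 - 3*c^5 * of_nat x + (c^6 - a) * 1)"
    by (rule sum.cong) (auto simp: algebra_simps power_numeral_reduce)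
  also have "\<dots> = (c^7/7 - c^6/2 + c^5/2 - c^3/6 + c/42) - 3*c * (c^6/6 - c^5/2 + 5*c^4/12 - c^2/12)
     + 6*c^2 * (c^5/5 - c^4/2 + c^3/3 - c/30) - 7*c^3 * (c^4/4 - c^3/2 + c^2/4)
     + 6*c^4 * (c^3/3 - c^2/2 + c/6) - 3*c^5 * (c^2/2 - c/2) + (c^6 - a) * (c - 1)"
    unfolding sum.distrib sum_subtractf sum_distrib_left [symmetric]
    using sum_powers_lessThan[OF assms(1), where 'a='a] by (simp only: c_def)
  also have "\<dots> = 83/140*c^7 - c^6 + c^5/2 - 7/60*c^3 + c/42 - (c - 1) * a"
    by (simp add: field_simps power_numeral_reduce)
  finally show ?thesis .
qed

lemma sum_product_form:
  assumes "0 < m"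
  defines "c \<equiv> of_nat m :: 'a::field_char_0"
  shows "(\<Sum>x=1..<m. (of_nat x * (c - of_nat x) * (of_nat x + (c - of_nat x))) ^ 2) = c^7/30 - c^3/30"
proof -
  have "(\<Sum>x=1..<m. (of_nat x * (c - of_nat x) * (of_nat x + (c - of_nat x))) ^ 2) =
    (\<Sum>x=1..<m. c^2 * of_nat x ^ 4 - 2*c^3 * of_nat x ^ 3 + c^4 * of_nat x ^ 2)"
    by (rule sum.cong) (auto simp: algebra_simps power_numeral_reduce)
  also have "\<dots> = c^2 * (c^5/5 - c^4/2 + c^3/3 - c/30) - 2*c^3 * (c^4/4 - c^3/2 + c^2/4)
     + c^4 * (c^3/3 - c^2/2 + c/6)"
    unfolding sum.distrib sum_subtractf sum_distrib_left [symmetric]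
    using sum_powers_lessThan[OF assms(1), where 'a='a] by (simp only: c_def)
  also have "\<dots> = c^7/30 - c^3/30"
    by (simp add: field_simps power_numeral_reduce)
  finally show ?thesis .
qed

lemma of_nat_divsum: "of_nat (divsum k n) = (\<Sum>d | d dvd n. of_nat d ^ k)"
  by (simp add: divsum_def)

text \<open>This is where the factor \<open>n\<close>, hence the derivative in Ramanujan's
  identities, comes from: \<open>p (n div d) 0\<close> is subtracted \<open>d - 1\<close> times, and
  \<open>d\<close> absorbs one of the factors \<open>n div d\<close>.\<close>

lemma sum_divisors_codivisor:
  assumes "0 < n"
  shows "(\<Sum>d | d dvd n. (of_nat d - 1) * of_nat (n div d) ^ Suc k) =
    (of_nat n * of_nat (divsum k n) - of_nat (divsum (Suc k) n) :: 'a::comm_ring_1)"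
proof -
  have "(\<Sum>d | d dvd n. (of_nat d - 1) * of_nat (n div d) ^ Suc k) =
    (\<Sum>d | d dvd n. of_nat n * of_nat (n div d) ^ k - of_nat (n div d) ^ Suc k :: 'a)"
  proof (rule sum.cong)
    fix d assume "d \<in> {d. d dvd n}"
    then have n_eq: "of_nat d * of_nat (n div d) = (of_nat n :: 'a)"
      by (metis mem_Collect_eq dvd_mult_div_cancel of_nat_mult)
    show "(of_nat d - 1) * of_nat (n div d) ^ Suc k =
        (of_nat n * of_nat (n div d) ^ k - of_nat (n div d) ^ Suc k :: 'a)"
      by (subst n_eq[symmetric]) (simp add: algebra_simps)
  qed simp
  also have "\<dots> = (\<Sum>d | d dvd n. of_nat n * of_nat d ^ k - of_nat d ^ Suc k)"
    by (rule sum_divisors_flip[OF assms])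
  also have "\<dots> = of_nat n * of_nat (divsum k n) - of_nat (divsum (Suc k) n)"
    by (simp add: sum_subtractf sum_distrib_left of_nat_divsum)
  finally show ?thesis .
qed

lemma divconv_3_1:
  assumes n: "0 < n"
  shows "8 * of_nat (divconv 3 1 n) = 7/10 * of_nat (divsum 5 n) - of_nat n * of_nat (divsum 3 n)
    + of_nat (divsum 3 n) / 3 - (of_nat (divsum 1 n) / 30 :: complex)"
proof -
  let ?p = "\<lambda>x y :: complex. (x^2 + x * y + y^2)^2"
  have "8 * of_nat (divconv 3 1 n) = 4 * of_nat (divconv 3 1 n) + 4 * (of_nat (divconv 1 3 n) :: complex)"
    using divconv_commute[of 1 3 n] by simp
  also have "\<dots> = (\<Sum>(a, b, x, y)\<in>reps n. 4 * (of_nat a ^ 3 * of_nat b ^ 1) + 4 * (of_nat a ^ 1 * of_nat b ^ 3))"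
    by (simp only: sum_reps_powers[symmetric] sum_distrib_left sum.distrib split_def)
  \<comment> \<open>With \<open>s = a^2 + b^2\<close> and \<open>t = a b\<close> the two values of
    \<open>?p\<close> are \<open>(s + t)^2\<close> and \<open>(s - t)^2\<close>, with difference
    \<open>4 s t\<close>.\<close>
  also have "\<dots> = (\<Sum>(a, b, x, y)\<in>reps n. ?p (of_nat a) (of_nat b) - ?p (of_nat b) (of_nat a - of_nat b))"
    by (rule sum.cong) (auto simp: algebra_simps power_numeral_reduce)
  also have "\<dots> = (\<Sum>d | d dvd n. \<Sum>x=1..<d. ?p (of_nat x) (of_nat d - of_nat x) - ?p (of_nat (n div d)) 0)"
    by (rule sum_reps_reduction[OF n]) (simp_all add: algebra_simps power2_eq_square)
  also have "\<dots> = (\<Sum>d | d dvd n. 7/10 * of_nat d ^ 5 - of_nat d ^ 4 + of_nat d ^ 3 / 3 - of_nat d ^ 1 / 30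
      - (of_nat d - 1) * of_nat (n div d) ^ Suc 3)"
    by (intro sum.cong refl, subst sum_norm_form_2) (auto dest: dvd_pos_nat[OF n] simp flip: power_mult)
  also have "\<dots> = 7/10 * of_nat (divsum 5 n) - of_nat n * of_nat (divsum 3 n)
    + of_nat (divsum 3 n) / 3 - of_nat (divsum 1 n) / 30"
    unfolding sum.distrib sum_subtractf sum_divisors_codivisor[OF n] of_nat_divsum
      sum_distrib_left[symmetric] sum_divide_distrib[symmetric] by simp
  finally show ?thesis .
qed

text \<open>In the notation \<open>s = a^2 + b^2\<close>, \<open>t = a b\<close>, the cubes give
  \<open>(s + t)^3 - (s - t)^3 = 6 s^2 t + 2 t^3\<close>, that is
  \<open>6 a^5 b + 6 a b^5 + 14 a^3 b^3\<close>. The two convolutions cannot be separated by this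
  choice of \<open>p\<close> alone.\<close>

lemma divconv_5_1:
  assumes n: "0 < n"
  shows "12 * of_nat (divconv 5 1 n) + 14 * of_nat (divconv 3 3 n) = 83/140 * of_nat (divsum 7 n)
    - of_nat n * of_nat (divsum 5 n) + of_nat (divsum 5 n) / 2 - 7/60 * of_nat (divsum 3 n)
    + (of_nat (divsum 1 n) / 42 :: complex)"
proof -
  let ?p = "\<lambda>x y :: complex. (x^2 + x * y + y^2)^3"
  have "12 * of_nat (divconv 5 1 n) + 14 * of_nat (divconv 3 3 n) =
      6 * of_nat (divconv 5 1 n) + 6 * of_nat (divconv 1 5 n) + 14 * (of_nat (divconv 3 3 n) :: complex)"
    using divconv_commute[of 1 5 n] by simp
  also have "\<dots> = (\<Sum>(a, b, x, y)\<in>reps n. 6 * (of_nat a ^ 5 * of_nat b ^ 1) + 6 * (of_nat a ^ 1 * of_nat b ^ 5)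
      + 14 * (of_nat a ^ 3 * of_nat b ^ 3))"
    by (simp only: sum_reps_powers[symmetric] sum_distrib_left sum.distrib split_def)
  also have "\<dots> = (\<Sum>(a, b, x, y)\<in>reps n. ?p (of_nat a) (of_nat b) - ?p (of_nat b) (of_nat a - of_nat b))"
    by (rule sum.cong) (auto simp: algebra_simps power_numeral_reduce)
  also have "\<dots> = (\<Sum>d | d dvd n. \<Sum>x=1..<d. ?p (of_nat x) (of_nat d - of_nat x) - ?p (of_nat (n div d)) 0)"
    by (rule sum_reps_reduction[OF n]) (simp_all add: algebra_simps power2_eq_square)
  also have "\<dots> = (\<Sum>d | d dvd n. 83/140 * of_nat d ^ 7 - of_nat d ^ 6 + of_nat d ^ 5 / 2 - 7/60 * of_nat d ^ 3
      + of_nat d ^ 1 / 42 - (of_nat d - 1) * of_nat (n div d) ^ Suc 5)"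
    by (intro sum.cong refl, subst sum_norm_form_3) (auto dest: dvd_pos_nat[OF n] simp flip: power_mult)
  also have "\<dots> = 83/140 * of_nat (divsum 7 n) - of_nat n * of_nat (divsum 5 n)
    + of_nat (divsum 5 n) / 2 - 7/60 * of_nat (divsum 3 n) + of_nat (divsum 1 n) / 42"
    unfolding sum.distrib sum_subtractf sum_divisors_codivisor[OF n] of_nat_divsum
      sum_distrib_left[symmetric] sum_divide_distrib[symmetric] by simp
  finally show ?thesis .
qed

text \<open>Here \<open>p x 0 = 0\<close>, so no term with a factor \<open>n\<close> arises. In
  terms of \<open>q\<close>-expansions this is \<open>E4^2 = E8\<close>.\<close>

lemma divconv_3_3:
  assumes n: "0 < n"
  shows "4 * of_nat (divconv 3 3 n) = of_nat (divsum 7 n) / 30 - (of_nat (divsum 3 n) / 30 :: complex)"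
proof -
  let ?p = "\<lambda>x y :: complex. (x * y * (x + y))^2"
  have "4 * (of_nat (divconv 3 3 n) :: complex) = (\<Sum>(a, b, x, y)\<in>reps n. 4 * (of_nat a ^ 3 * of_nat b ^ 3))"
    by (simp only: sum_reps_powers[symmetric] sum_distrib_left split_def)
  also have "\<dots> = (\<Sum>(a, b, x, y)\<in>reps n. ?p (of_nat a) (of_nat b) - ?p (of_nat b) (of_nat a - of_nat b))"
    by (rule sum.cong) (auto simp: algebra_simps power_numeral_reduce)
  also have "\<dots> = (\<Sum>d | d dvd n. \<Sum>x=1..<d. ?p (of_nat x) (of_nat d - of_nat x) - ?p (of_nat (n div d)) 0)"
    by (rule sum_reps_reduction[OF n]) (simp_all add: algebra_simps power2_eq_square)
  also have "\<dots> = (\<Sum>d | d dvd n. of_nat d ^ 7 / 30 - of_nat d ^ 3 / 30)"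
  proof (intro sum.cong refl)
    fix d assume "d \<in> {d. d dvd n}"
    then have "0 < d" using dvd_pos_nat[OF n] by auto
    from sum_product_form[OF this, where 'a = complex]
    show "(\<Sum>x=1..<d. ?p (of_nat x) (of_nat d - of_nat x) - ?p (of_nat (n div d)) 0) =
      of_nat d ^ 7 / 30 - of_nat d ^ 3 / 30" by simp
  qed
  also have "\<dots> = of_nat (divsum 7 n) / 30 - of_nat (divsum 3 n) / 30"
    unfolding sum_subtractf of_nat_divsum sum_divide_distrib[symmetric] by simp
  finally show ?thesis .
qed

section \<open>Ramanujan's identities\<close>

definition sigma_fps :: "nat \<Rightarrow> complex fps" where
  "sigma_fps k = Abs_fps (\<lambda>n. of_nat (divsum k n))"

text \<open>Note that \<open>divsum k 0 = 0\<close>, being a sum over the infinite set of all naturals.\<close>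

lemma divsum_0 [simp]: "divsum k 0 = 0"
  by (simp add: divsum_def)

lemma sigma_fps_nth: "fps_nth (sigma_fps k) n = of_nat (divsum k n)"
  by (simp add: sigma_fps_def)

lemma sigma_fps_mult_nth: "fps_nth (sigma_fps i * sigma_fps j) n = of_nat (divconv i j n)"
proof -
  have "fps_nth (sigma_fps i * sigma_fps j) n =
    (\<Sum>k=0..n. of_nat (divsum i k * divsum j (n - k)))"
    by (simp add: fps_mult_nth sigma_fps_nth)
  also have "\<dots> = (\<Sum>k=1..<n. of_nat (divsum i k * divsum j (n - k)))"
    \<comment> \<open>The end terms \<open>k = 0\<close> and \<open>k = n\<close> vanish by
      \<open>divsum_0\<close>.\<close>
    by (rule sum.mono_neutral_right) (auto simp: not_less_eq_eq)
  finally show ?thesis by (simp add: divconv_def)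
qed

text \<open>This is \<open>E4' - E2 E4 / 3 = - E6 / 3\<close> after inserting
  \<open>E2 = 1 - 24 S1\<close>, \<open>E4 = 1 + 240 S3\<close>, \<open>E6 = 1 - 504 S5\<close> and
  cancelling the constant terms.\<close>

lemma sigma_fps_3_1:
  "240 * (fps_X * fps_deriv (sigma_fps 3)) - 80 * sigma_fps 3 + 8 * sigma_fps 1
    + 1920 * (sigma_fps 1 * sigma_fps 3) = 168 * sigma_fps 5"
proof (rule fps_ext)
  fix n
  show "fps_nth (240 * (fps_X * fps_deriv (sigma_fps 3)) - 80 * sigma_fps 3 + 8 * sigma_fps 1
    + 1920 * (sigma_fps 1 * sigma_fps 3)) n = fps_nth (168 * sigma_fps 5) n"
  proof (cases "n = 0")
    case False
    then have eq: "of_nat (divconv 1 3 n) = (7/10 * of_nat (divsum 5 n) - of_nat n * of_nat (divsum 3 n)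
        + of_nat (divsum 3 n) / 3 - of_nat (divsum 1 n) / 30) / (8 :: complex)"
      using divconv_3_1[of n] unfolding divconv_commute[of 1 3]
      by (simp add: eq_divide_eq mult.commute del: One_nat_def)
    show ?thesis using False
      by (simp add: numeral_fps_const sigma_fps_mult_nth sigma_fps_nth eq del: One_nat_def)
         (simp add: field_simps)
  qed (simp add: numeral_fps_const sigma_fps_mult_nth sigma_fps_nth divconv_def)
qed

text \<open>Likewise \<open>E6' - E2 E6 / 2 = - E4^2 / 2\<close>, with all signs reversed.\<close>

lemma sigma_fps_5_1:
  "504 * (fps_X * fps_deriv (sigma_fps 5)) - 252 * sigma_fps 5 - 12 * sigma_fps 1
    + 6048 * (sigma_fps 1 * sigma_fps 5) = 240 * sigma_fps 3 + 28800 * (sigma_fps 3 * sigma_fps 3)"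
proof (rule fps_ext)
  fix n
  show "fps_nth (504 * (fps_X * fps_deriv (sigma_fps 5)) - 252 * sigma_fps 5 - 12 * sigma_fps 1
    + 6048 * (sigma_fps 1 * sigma_fps 5)) n =
    fps_nth (240 * sigma_fps 3 + 28800 * (sigma_fps 3 * sigma_fps 3)) n"
  proof (cases "n = 0")
    case False
    then have eq1: "of_nat (divconv 3 3 n) = (of_nat (divsum 7 n) - of_nat (divsum 3 n)) / (120 :: complex)"
      using divconv_3_3[of n] by (simp add: field_simps)
    have "of_nat (divconv 1 5 n) = 12 * of_nat (divconv 1 5 n) / (12 :: complex)" by simp
    also have "12 * of_nat (divconv 1 5 n) = 83/140 * of_nat (divsum 7 n)
        - of_nat n * of_nat (divsum 5 n) + of_nat (divsum 5 n) / 2 - 7/60 * of_nat (divsum 3 n)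
        + of_nat (divsum 1 n) / 42 - 14 * (of_nat (divconv 3 3 n) :: complex)"
      using divconv_5_1[of n] False unfolding divconv_commute[of 1 5]
      by (simp add: eq_diff_eq del: One_nat_def)
    finally have eq2: "of_nat (divconv 1 5 n) = (83/140 * of_nat (divsum 7 n)
        - of_nat n * of_nat (divsum 5 n) + of_nat (divsum 5 n) / 2 - 7/60 * of_nat (divsum 3 n)
        + of_nat (divsum 1 n) / 42 - 14 * of_nat (divconv 3 3 n)) / (12 :: complex)" .
    \<comment> \<open>After both substitutions \<open>sigma_7\<close> occurs with coefficient 240 on
      either side and cancels.\<close>
    show ?thesis using False
      by (simp add: numeral_fps_const sigma_fps_mult_nth sigma_fps_nth eq1 eq2 del: One_nat_def)
         (simp add: field_simps)
  qed (simp add: numeral_fps_const sigma_fps_mult_nth sigma_fps_nth divconv_def)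
qed

section \<open>Convergence, holomorphy and derivatives of the \<open>q\<close>-series\<close>

lemma conv_radius_power_coeffs: "conv_radius (\<lambda>n. of_nat n ^ m :: complex) \<ge> 1"
proof (induction m)
  case 0
  show ?case
  proof (rule conv_radius_geI_ex)
    fix r :: real assume "0 < r" "ereal r < 1"
    then show "\<exists>z. norm z = r \<and> summable (\<lambda>n. of_nat n ^ 0 * z ^ n :: complex)"
      by (intro exI[of _ "of_real r"]) (auto intro: summable_geometric)
  qed
next
  case (Suc m)
  \<comment> \<open>\<open>X d/dX\<close> raises the exponent by one, and differentiation does not
    shrink the radius; the induction starts from the geometric series.\<close>
  have eq: "Abs_fps (\<lambda>n. of_nat n ^ Suc m :: complex) = fps_X * fps_deriv (Abs_fps (\<lambda>n. of_nat n ^ m))"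
    by (rule fps_ext) auto
  have "1 \<le> fps_conv_radius (fps_deriv (Abs_fps (\<lambda>n. of_nat n ^ m :: complex)))"
    using Suc by (intro order.trans[OF _ fps_conv_radius_deriv]) (simp add: fps_conv_radius_def)
  then have "1 \<le> fps_conv_radius (Abs_fps (\<lambda>n. of_nat n ^ Suc m :: complex))"
    unfolding eq by (intro fps_conv_radius_mult_ge) auto
  then show ?case by (simp add: fps_conv_radius_def)
qed

lemma divsum_le: "divsum k n \<le> n ^ Suc k"
proof (cases "n = 0")
  case False
  have "divsum k n \<le> (\<Sum>d | d dvd n. n ^ k)"
    unfolding divsum_def using False by (intro sum_mono power_mono) (auto dest: dvd_imp_le)
  also have "\<dots> = card {d. d dvd n} * n ^ k" by simp
  also have "card {d. d dvd n} \<le> card {1..n}"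
    using False by (intro card_mono) (auto dest: dvd_imp_le dvd_pos_nat[of n] simp: Suc_le_eq)
  finally show ?thesis by simp
qed simp

lemma sigma_fps_conv_radius: "fps_conv_radius (sigma_fps k) \<ge> 1"
  unfolding fps_conv_radius_def
proof (rule conv_radius_geI_ex)
  fix r :: real assume r: "0 < r" "ereal r < 1"
  have "summable (\<lambda>n. norm (of_nat n ^ Suc k * of_real r ^ n :: complex))"
    using less_le_trans[OF r(2) conv_radius_power_coeffs[of "Suc k"]] r(1)
    by (intro abs_summable_in_conv_radius) simp
  then have "summable (\<lambda>n. fps_nth (sigma_fps k) n * of_real r ^ n)"
  proof (rule summable_comparison_test'[where N = 0])
    fix n
    have "real (divsum k n) \<le> real (n ^ Suc k)"
      using divsum_le[of k n] by (simp only: of_nat_le_iff)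
    with r show "norm (fps_nth (sigma_fps k) n * of_real r ^ n) \<le>
        norm (of_nat n ^ Suc k * of_real r ^ n :: complex)"
      by (simp add: sigma_fps_nth norm_mult norm_power mult_right_mono del: power_Suc)
  qed
  with r show "\<exists>z. norm z = r \<and> summable (\<lambda>n. fps_nth (sigma_fps k) n * z ^ n)"
    by (intro exI[of _ "of_real r"]) auto
qed

lemma qpar_norm_less_1: "z \<in> UHP \<Longrightarrow> norm (qpar z) < 1"
  by (simp add: qpar_def UHP_def)

lemma qpar_in_disc: "z \<in> UHP \<Longrightarrow> ereal (norm (qpar z)) < fps_conv_radius (sigma_fps k)"
  by (rule less_le_trans[OF _ sigma_fps_conv_radius]) (simp add: qpar_norm_less_1 one_ereal_def)

lemma eval_sigma_fps:
  assumes "z \<in> UHP"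
  shows "(\<Sum>n. of_nat (divsum k (Suc n)) * qpar z ^ Suc n) = eval_fps (sigma_fps k) (qpar z)"
proof -
  have "summable (\<lambda>n. fps_nth (sigma_fps k) n * qpar z ^ n)"
    by (rule summable_fps[OF qpar_in_disc[OF assms]])
  from suminf_split_head[OF this] show ?thesis
    by (simp add: eval_fps_def sigma_fps_nth)
qed

lemma E2_eval: "z \<in> UHP \<Longrightarrow> E2 z = 1 - 24 * eval_fps (sigma_fps 1) (qpar z)"
  and E4_eval: "z \<in> UHP \<Longrightarrow> E4 z = 1 + 240 * eval_fps (sigma_fps 3) (qpar z)"
  and E6_eval: "z \<in> UHP \<Longrightarrow> E6 z = 1 - 504 * eval_fps (sigma_fps 5) (qpar z)"
  by (simp_all add: E2_def E4_def E6_def eval_sigma_fps del: power_Suc)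

lemma open_UHP: "open UHP"
  unfolding UHP_def by (rule open_halfspace_Im_gt)

lemma connected_UHP: "connected UHP"
  unfolding UHP_def by (intro convex_connected convex_halfspace_Im_gt)

text \<open>Chain rule: \<open>qpar' = 2 pi i qpar\<close>, so differentiation in \<open>z\<close>
  divided by \<open>2 pi i\<close> is \<open>X d/dX\<close> on the power series.\<close>

lemma sigma_q_has_derivative:
  assumes "z \<in> UHP"
  shows "((\<lambda>z. eval_fps (sigma_fps k) (qpar z)) has_field_derivative
    2 * pi * \<i> * eval_fps (fps_X * fps_deriv (sigma_fps k)) (qpar z)) (at z)"
proof -
  have q: "(qpar has_field_derivative qpar z * (2 * pi * \<i>)) (at z)"
    unfolding qpar_def by (auto intro!: derivative_eq_intros)
  have rad: "ereal (norm (qpar z)) < fps_conv_radius (fps_deriv (sigma_fps k))"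
    by (rule less_le_trans[OF qpar_in_disc[OF assms] fps_conv_radius_deriv])
  show ?thesis
    using DERIV_chain2[OF has_field_derivative_eval_fps[OF qpar_in_disc[OF assms]] q] rad
    by (simp add: eval_fps_mult mult_ac)
qed

lemma holomorphic_sigma_q: "(\<lambda>z. eval_fps (sigma_fps k) (qpar z)) holomorphic_on UHP"
  using sigma_q_has_derivative open_UHP holomorphic_on_open by blast

lemma holomorphic_E2: "E2 holomorphic_on UHP"
  by (subst holomorphic_cong[OF refl E2_eval]) (auto intro!: holomorphic_on_diff holomorphic_on_mult holomorphic_sigma_q)

lemma holomorphic_E4: "E4 holomorphic_on UHP"
  by (subst holomorphic_cong[OF refl E4_eval]) (auto intro!: holomorphic_on_add holomorphic_on_mult holomorphic_sigma_q)

lemma holomorphic_E6: "E6 holomorphic_on UHP"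
  by (subst holomorphic_cong[OF refl E6_eval]) (auto intro!: holomorphic_on_diff holomorphic_on_mult holomorphic_sigma_q)

lemma nderiv_E4:
  assumes "z \<in> UHP"
  shows "nderiv E4 z = 240 * eval_fps (fps_X * fps_deriv (sigma_fps 3)) (qpar z)"
proof -
  have "((\<lambda>z. 1 + 240 * eval_fps (sigma_fps 3) (qpar z)) has_field_derivative
    240 * (2 * pi * \<i> * eval_fps (fps_X * fps_deriv (sigma_fps 3)) (qpar z))) (at z)"
    using DERIV_add[OF DERIV_const DERIV_cmult[OF sigma_q_has_derivative[OF assms, of 3], of "240"], of 1]
    by simp
  then have "(E4 has_field_derivative
    240 * (2 * pi * \<i> * eval_fps (fps_X * fps_deriv (sigma_fps 3)) (qpar z))) (at z)"
    by (rule has_field_derivative_transform_within_open[OF _ open_UHP assms]) (simp add: E4_eval)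
  then show ?thesis by (simp add: nderiv_def DERIV_imp_deriv)
qed

lemma nderiv_E6:
  assumes "z \<in> UHP"
  shows "nderiv E6 z = - 504 * eval_fps (fps_X * fps_deriv (sigma_fps 5)) (qpar z)"
proof -
  have "((\<lambda>z. 1 - 504 * eval_fps (sigma_fps 5) (qpar z)) has_field_derivative
    - 504 * (2 * pi * \<i> * eval_fps (fps_X * fps_deriv (sigma_fps 5)) (qpar z))) (at z)"
    using DERIV_add[OF DERIV_const DERIV_cmult[OF sigma_q_has_derivative[OF assms, of 5], of "- 504"], of 1]
    by simp
  then have "(E6 has_field_derivative
    - 504 * (2 * pi * \<i> * eval_fps (fps_X * fps_deriv (sigma_fps 5)) (qpar z))) (at z)"
    by (rule has_field_derivative_transform_within_open[OF _ open_UHP assms]) (simp add: E6_eval)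
  then show ?thesis by (simp add: nderiv_def DERIV_imp_deriv)
qed

text \<open>The side conditions are bounds of the radii by 1, which \<open>conv_radius_ge_1\<close>
  discharges by the shape of the series.\<close>

lemma eval_fps_unit_disc:
  fixes f g :: "complex fps"
  assumes "norm q < 1"
  shows "1 \<le> fps_conv_radius f \<Longrightarrow> 1 \<le> fps_conv_radius g \<Longrightarrow> eval_fps (f * g) q = eval_fps f q * eval_fps g q"
    and "1 \<le> fps_conv_radius f \<Longrightarrow> 1 \<le> fps_conv_radius g \<Longrightarrow> eval_fps (f + g) q = eval_fps f q + eval_fps g q"
    and "1 \<le> fps_conv_radius f \<Longrightarrow> 1 \<le> fps_conv_radius g \<Longrightarrow> eval_fps (f - g) q = eval_fps f q - eval_fps g q"
proof -
  have q: "ereal (norm q) < 1" using assms by (simp add: one_ereal_def)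
  assume "1 \<le> fps_conv_radius f" "1 \<le> fps_conv_radius g"
  note * = less_le_trans[OF q this(1)] less_le_trans[OF q this(2)]
  show "eval_fps (f * g) q = eval_fps f q * eval_fps g q" by (rule eval_fps_mult[OF *])
  show "eval_fps (f + g) q = eval_fps f q + eval_fps g q" by (rule eval_fps_add[OF *])
  show "eval_fps (f - g) q = eval_fps f q - eval_fps g q" by (rule eval_fps_diff[OF *])
qed

lemmas conv_radius_ge_1 = sigma_fps_conv_radius fps_conv_radius_mult_ge
  fps_conv_radius_diff_ge fps_conv_radius_add_ge order.trans[OF sigma_fps_conv_radius fps_conv_radius_deriv]

lemma ramanujan_E4:
  assumes "z \<in> UHP"
  shows "serre 4 E4 z = - E6 z / 3"
proof -
  note ev = eval_fps_unit_disc[OF qpar_norm_less_1[OF assms]]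
  define D where "D = fps_X * fps_deriv (sigma_fps 3)"
  have D: "1 \<le> fps_conv_radius D" unfolding D_def by (intro conv_radius_ge_1) auto
  have "eval_fps (240 * D - 80 * sigma_fps 3 + 8 * sigma_fps 1
    + 1920 * (sigma_fps 1 * sigma_fps 3)) (qpar z) = eval_fps (168 * sigma_fps 5) (qpar z)"
    unfolding D_def by (rule arg_cong[OF sigma_fps_3_1])
  then have eq: "eval_fps D (qpar z) = (168 * eval_fps (sigma_fps 5) (qpar z)
      + 80 * eval_fps (sigma_fps 3) (qpar z) - 8 * eval_fps (sigma_fps 1) (qpar z)
      - 1920 * (eval_fps (sigma_fps 1) (qpar z) * eval_fps (sigma_fps 3) (qpar z))) / 240"
    by (simp add: ev conv_radius_ge_1 D algebra_simps del: One_nat_def)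
  show ?thesis
    unfolding serre_def nderiv_E4[OF assms] E2_eval[OF assms] E4_eval[OF assms] E6_eval[OF assms]
      D_def[symmetric] eq by (simp add: field_simps)
qed

lemma ramanujan_E6:
  assumes "z \<in> UHP"
  shows "serre 6 E6 z = - (E4 z ^ 2) / 2"
proof -
  note ev = eval_fps_unit_disc[OF qpar_norm_less_1[OF assms]]
  define D where "D = fps_X * fps_deriv (sigma_fps 5)"
  have D: "1 \<le> fps_conv_radius D" unfolding D_def by (intro conv_radius_ge_1) auto
  have "eval_fps (504 * D - 252 * sigma_fps 5 - 12 * sigma_fps 1
    + 6048 * (sigma_fps 1 * sigma_fps 5)) (qpar z)
    = eval_fps (240 * sigma_fps 3 + 28800 * (sigma_fps 3 * sigma_fps 3)) (qpar z)"
    unfolding D_def by (rule arg_cong[OF sigma_fps_5_1])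
  then have eq: "eval_fps D (qpar z) = (240 * eval_fps (sigma_fps 3) (qpar z)
      + 28800 * (eval_fps (sigma_fps 3) (qpar z) * eval_fps (sigma_fps 3) (qpar z))
      + 252 * eval_fps (sigma_fps 5) (qpar z) + 12 * eval_fps (sigma_fps 1) (qpar z)
      - 6048 * (eval_fps (sigma_fps 1) (qpar z) * eval_fps (sigma_fps 5) (qpar z))) / 504"
    by (simp add: ev conv_radius_ge_1 D algebra_simps del: One_nat_def)
  show ?thesis
    unfolding serre_def nderiv_E6[OF assms] E2_eval[OF assms] E4_eval[OF assms] E6_eval[OF assms]
      D_def[symmetric] eq by (simp add: field_simps power2_eq_square)
qed

section \<open>Saturated left ideals in differential operator rings\<close>

text \<open>M is a commutative domain stable under the commutator with \<open>d\<close>, and R is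
  the ring that M and \<open>d\<close> generate inside the ambient ring. \<open>R_least\<close>
  expresses generation as an induction principle; below it is applied to sets of left multipliers,
  which are closed under sums and products.\<close>

locale derivation_extension =
  fixes R M :: "'a::ring_1 set" and d :: 'a
  assumes M_0: "0 \<in> M" and M_1: "1 \<in> M" and M_minus_1: "- 1 \<in> M"
    and M_add: "f \<in> M \<Longrightarrow> g \<in> M \<Longrightarrow> f + g \<in> M"
    and M_mult: "f \<in> M \<Longrightarrow> g \<in> M \<Longrightarrow> f * g \<in> M"
    and M_commute: "f \<in> M \<Longrightarrow> g \<in> M \<Longrightarrow> f * g = g * f"
    and M_nonzero: "f \<in> M \<Longrightarrow> g \<in> M \<Longrightarrow> f \<noteq> 0 \<Longrightarrow> g \<noteq> 0 \<Longrightarrow> f * g \<noteq> 0"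
    and M_commutator: "f \<in> M \<Longrightarrow> d * f - f * d \<in> M"
    and M_R: "f \<in> M \<Longrightarrow> f \<in> R" and R_d: "d \<in> R"
    and R_add: "r \<in> R \<Longrightarrow> s \<in> R \<Longrightarrow> r + s \<in> R"
    and R_mult: "r \<in> R \<Longrightarrow> s \<in> R \<Longrightarrow> r * s \<in> R"
    and R_least: "M \<subseteq> S \<Longrightarrow> d \<in> S \<Longrightarrow> (\<And>r s. r \<in> S \<Longrightarrow> s \<in> S \<Longrightarrow> r + s \<in> S) \<Longrightarrow>
      (\<And>r s. r \<in> S \<Longrightarrow> s \<in> S \<Longrightarrow> r * s \<in> S) \<Longrightarrow> R \<subseteq> S"
begin

definition lideal :: "'a set \<Rightarrow> bool" where
  "lideal I \<longleftrightarrow> I \<subseteq> R \<and> 0 \<in> I \<and> (\<forall>a\<in>I. \<forall>b\<in>I. a + b \<in> I) \<and> (\<forall>r\<in>R. \<forall>a\<in>I. r * a \<in> I)"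

definition saturation :: "'a \<Rightarrow> 'a set" where
  "saturation a = {b \<in> R. \<exists>f\<in>M. f \<noteq> 0 \<and> (\<exists>r\<in>R. f * b = r * a)}"

lemma R_uminus: "r \<in> R \<Longrightarrow> - r \<in> R"
  using R_mult[OF M_R[OF M_minus_1]] by simp

lemma R_diff: "r \<in> R \<Longrightarrow> s \<in> R \<Longrightarrow> r - s \<in> R"
  using R_add[OF _ R_uminus] by simp

lemma R_power: "d ^ n \<in> R"
  by (induction n) (simp_all add: M_R M_1 R_d R_mult)

lemma lideal_R_mult: "lideal I \<Longrightarrow> r \<in> R \<Longrightarrow> a \<in> I \<Longrightarrow> r * a \<in> I"
  by (simp add: lideal_def)

lemma lideal_diff: "lideal I \<Longrightarrow> a \<in> I \<Longrightarrow> b \<in> I \<Longrightarrow> a - b \<in> I"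
  using lideal_R_mult[OF _ M_R[OF M_minus_1], of I b] unfolding lideal_def
  by (metis diff_conv_add_uminus mult_minus1)

lemma saturationI: "b \<in> R \<Longrightarrow> f \<in> M \<Longrightarrow> f \<noteq> 0 \<Longrightarrow> r \<in> R \<Longrightarrow> f * b = r * a \<Longrightarrow> b \<in> saturation a"
  by (auto simp: saturation_def)

lemma zero_in_saturation: "0 \<in> saturation a"
  by (rule saturationI[of _ 1 0]) (simp_all add: M_R M_0 M_1)

text \<open>Denominators \<open>f\<close> of \<open>b\<close> and \<open>g\<close> of
  \<open>c\<close> have the common denominator \<open>f * g\<close>, because they commute and M is a
  domain.\<close>

lemma saturation_add:
  assumes "b \<in> saturation a" "c \<in> saturation a"
  shows "b + c \<in> saturation a"
proof -
  obtain f r g s where h: "f \<in> M" "f \<noteq> 0" "r \<in> R" "f * b = r * a"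
      "g \<in> M" "g \<noteq> 0" "s \<in> R" "g * c = s * a" "b \<in> R" "c \<in> R"
    using assms by (auto simp: saturation_def)
  have "f * g * (b + c) = g * (f * b) + f * (g * c)"
    by (simp add: distrib_left mult.assoc[symmetric] M_commute[OF h(1,5)])
  also have "\<dots> = (g * r + f * s) * a"
    by (simp add: h(4,8) algebra_simps)
  finally show ?thesis
    using h by (intro saturationI[of _ "f * g" "g * r + f * s"] M_mult M_nonzero R_add R_mult) (auto intro: M_R)
qed

lemma saturation_M_mult:
  assumes "g \<in> M" "b \<in> saturation a"
  shows "g * b \<in> saturation a"
proof -
  obtain f r where h: "f \<in> M" "f \<noteq> 0" "r \<in> R" "f * b = r * a" "b \<in> R"
    using assms by (auto simp: saturation_def)
  have "f * (g * b) = g * (f * b)"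
    by (simp add: mult.assoc[symmetric] M_commute[OF h(1) assms(1)])
  also have "\<dots> = (g * r) * a" by (simp add: h(4) mult.assoc)
  finally show ?thesis
    using h assms by (intro saturationI[of _ f "g * r"] R_mult) (auto intro: M_R)
qed

text \<open>One factor \<open>f\<close> is not enough: moving \<open>d\<close> past \<open>f\<close>
  leaves the term \<open>f' * b\<close>, and a second \<open>f\<close>, which commutes with
  \<open>f'\<close>, brings it into \<open>R a\<close>.\<close>

lemma saturation_d_mult:
  assumes "b \<in> saturation a"
  shows "d * b \<in> saturation a"
proof -
  obtain f r where h: "f \<in> M" "f \<noteq> 0" "r \<in> R" "f * b = r * a" "b \<in> R"
    using assms by (auto simp: saturation_def)
  define f' where "f' = d * f - f * d"
  have f': "f' \<in> M" unfolding f'_def by (rule M_commutator[OF h(1)])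
  have "f * d = d * f - f'" by (simp add: f'_def)
  then have "f * f * (d * b) = f * (d * f - f') * b" by (metis mult.assoc)
  also have "\<dots> = f * d * (f * b) - f' * (f * b)"
  proof -
    have "f * (f' * b) = f' * (f * b)"
      by (simp add: mult.assoc[symmetric] M_commute[OF h(1) f'])
    then show ?thesis by (simp add: algebra_simps)
  qed
  also have "\<dots> = (f * d * r - f' * r) * a"
    by (simp add: h(4) algebra_simps)
  finally show ?thesis
    using h f' by (intro saturationI[of _ "f * f" "f * d * r - f' * r"] M_mult M_nonzero R_diff R_mult)
      (auto intro: M_R R_d)
qed

lemma lideal_saturation:
  assumes "a \<in> R"
  shows "lideal (saturation a)"
proof -
  \<comment> \<open>The elements that map the saturation into itself by left multiplication contain
    M and \<open>d\<close> and form a set closed under sums and products.\<close>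
  have "R \<subseteq> {r. \<forall>b\<in>saturation a. r * b \<in> saturation a}"
    by (rule R_least)
       (auto simp: saturation_M_mult saturation_d_mult saturation_add distrib_right mult.assoc)
  then show ?thesis
    by (auto simp: lideal_def zero_in_saturation saturation_add) (simp add: saturation_def)
qed

section \<open>Normal forms with coefficients in M on the left of powers of \<open>d\<close>\<close>

primrec opdeg_lt :: "nat \<Rightarrow> 'a set" where
  "opdeg_lt 0 = {0}"
| "opdeg_lt (Suc n) = {f * d ^ n + w | f w. f \<in> M \<and> w \<in> opdeg_lt n}"

lemma opdeg_lt_SucI: "f \<in> M \<Longrightarrow> w \<in> opdeg_lt n \<Longrightarrow> f * d ^ n + w \<in> opdeg_lt (Suc n)"
  by auto

lemma zero_opdeg_lt: "0 \<in> opdeg_lt n"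
  by (induction n) (auto intro: exI[of _ 0] simp: M_0)

lemma opdeg_lt_Suc_mono: "w \<in> opdeg_lt n \<Longrightarrow> w \<in> opdeg_lt (Suc n)"
  using opdeg_lt_SucI[OF M_0, of w n] by simp

lemma opdeg_lt_mono: "w \<in> opdeg_lt m \<Longrightarrow> m \<le> n \<Longrightarrow> w \<in> opdeg_lt n"
  by (induction n rule: nat_induct) (auto simp: le_Suc_eq simp del: opdeg_lt.simps intro: opdeg_lt_Suc_mono)

lemma opdeg_lt_add: "v \<in> opdeg_lt n \<Longrightarrow> w \<in> opdeg_lt n \<Longrightarrow> v + w \<in> opdeg_lt n"
proof (induction n arbitrary: v w)
  case (Suc n)
  then obtain f v' g w' where "v = f * d ^ n + v'" "w = g * d ^ n + w'" "f \<in> M" "g \<in> M"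
      "v' \<in> opdeg_lt n" "w' \<in> opdeg_lt n" by auto
  then have "v + w = (f + g) * d ^ n + (v' + w')" "f + g \<in> M" "v' + w' \<in> opdeg_lt n"
    by (auto simp: algebra_simps M_add Suc.IH)
  then show ?case using opdeg_lt_SucI by simp
qed simp

lemma opdeg_lt_M_mult: "g \<in> M \<Longrightarrow> w \<in> opdeg_lt n \<Longrightarrow> g * w \<in> opdeg_lt n"
proof (induction n arbitrary: w)
  case (Suc n)
  then obtain f w' where "w = f * d ^ n + w'" "f \<in> M" "w' \<in> opdeg_lt n" by auto
  with Suc have "g * w = (g * f) * d ^ n + g * w'" "g * f \<in> M" "g * w' \<in> opdeg_lt n"
    by (auto simp: algebra_simps M_mult)
  then show ?case using opdeg_lt_SucI by simp
qed simp

lemma opdeg_lt_diff: "v \<in> opdeg_lt n \<Longrightarrow> w \<in> opdeg_lt n \<Longrightarrow> v - w \<in> opdeg_lt n"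
  using opdeg_lt_add[OF _ opdeg_lt_M_mult[OF M_minus_1], of v n w] by simp

text \<open>\<open>d f d^n = f d^(n+1) + (d f - f d) d^n\<close>, and the commutator is again a
  coefficient.\<close>

lemma opdeg_lt_d_mult: "w \<in> opdeg_lt n \<Longrightarrow> d * w \<in> opdeg_lt (Suc n)"
proof (induction n arbitrary: w)
  case 0
  then show ?case using zero_opdeg_lt[of "Suc 0"] by simp
next
  case (Suc n)
  then obtain f w' where w: "w = f * d ^ n + w'" "f \<in> M" "w' \<in> opdeg_lt n" by auto
  have "d * w = f * d ^ Suc n + ((d * f - f * d) * d ^ n + d * w')"
    by (simp add: w(1) algebra_simps)
  moreover have "(d * f - f * d) * d ^ n + 0 \<in> opdeg_lt (Suc n)"
    by (intro opdeg_lt_SucI M_commutator w zero_opdeg_lt)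
  then have "(d * f - f * d) * d ^ n + d * w' \<in> opdeg_lt (Suc n)"
    using opdeg_lt_add[OF _ Suc.IH[OF w(3)]] by simp
  ultimately show ?case using opdeg_lt_SucI[OF w(2)] by metis
qed

text \<open>The normal forms are stable under left multiplication by M and by \<open>d\<close>,
  hence by R; applying \<open>r\<close> to the normal form 1 yields one for
  \<open>r\<close>.\<close>

lemma R_opdeg_lt:
  assumes "r \<in> R"
  obtains n where "r \<in> opdeg_lt n"
proof -
  let ?W = "\<Union>n. opdeg_lt n"
  have "R \<subseteq> {r. \<forall>u\<in>?W. r * u \<in> ?W}"
  proof (rule R_least)
    show "M \<subseteq> {r. \<forall>u\<in>?W. r * u \<in> ?W}" using opdeg_lt_M_mult by blast
    show "d \<in> {r. \<forall>u\<in>?W. r * u \<in> ?W}" using opdeg_lt_d_mult by blast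
    fix r s assume rs: "r \<in> {r. \<forall>u\<in>?W. r * u \<in> ?W}" "s \<in> {r. \<forall>u\<in>?W. r * u \<in> ?W}"
    have "r * s * u \<in> ?W" if "u \<in> ?W" for u
    proof -
      from rs that have "s * u \<in> ?W" by blast
      with rs show ?thesis unfolding mult.assoc by blast
    qed
    then show "r * s \<in> {r. \<forall>u\<in>?W. r * u \<in> ?W}" by blast
    have "(r + s) * u \<in> ?W" if "u \<in> ?W" for u
    proof -
      from rs that obtain m n where "r * u \<in> opdeg_lt m" "s * u \<in> opdeg_lt n" by blast
      then have "r * u + s * u \<in> opdeg_lt (max m n)"
        by (intro opdeg_lt_add) (auto elim: opdeg_lt_mono)
      then show ?thesis unfolding distrib_right by blast
    qed
    then show "r + s \<in> {r. \<forall>u\<in>?W. r * u \<in> ?W}" by blast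
  qed
  moreover have "1 \<in> opdeg_lt (Suc 0)"
    using opdeg_lt_SucI[OF M_1 zero_opdeg_lt, of 0] by (simp del: opdeg_lt.simps)
  ultimately have "r * 1 \<in> ?W" using assms by blast
  then show ?thesis using that by auto
qed

text \<open>Commutators only contribute in lower order, so the leading coefficient stays
  \<open>f\<close> while the order rises by \<open>j\<close>.\<close>

lemma power_mult_leading:
  assumes "f \<in> M" "w \<in> opdeg_lt n"
  shows "\<exists>w'\<in>opdeg_lt (n + j). d ^ j * (f * d ^ n + w) = f * d ^ (n + j) + w'"
proof (induction j)
  case 0
  then show ?case using assms by auto
next
  case (Suc j)
  then obtain w' where w': "w' \<in> opdeg_lt (n + j)" "d ^ j * (f * d ^ n + w) = f * d ^ (n + j) + w'"
    by auto
  have "(d * f - f * d) * d ^ (n + j) + 0 \<in> opdeg_lt (Suc (n + j))"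
    by (intro opdeg_lt_SucI M_commutator assms zero_opdeg_lt)
  then have "(d * f - f * d) * d ^ (n + j) + d * w' \<in> opdeg_lt (n + Suc j)"
    using opdeg_lt_add[OF _ opdeg_lt_d_mult[OF w'(1)]] by simp
  moreover have "d ^ Suc j * (f * d ^ n + w) = d * (d ^ j * (f * d ^ n + w))"
    by (simp add: mult.assoc)
  then have "d ^ Suc j * (f * d ^ n + w) =
      f * d ^ (n + Suc j) + ((d * f - f * d) * d ^ (n + j) + d * w')"
    unfolding w'(2) by (simp add: algebra_simps)
  ultimately show ?case by blast
qed

lemma opdeg_lt_leading:
  "b \<in> opdeg_lt n \<Longrightarrow> b \<noteq> 0 \<Longrightarrow> \<exists>m<n. \<exists>f\<in>M. f \<noteq> 0 \<and> (\<exists>w\<in>opdeg_lt m. b = f * d ^ m + w)"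
proof (induction n)
  case (Suc n)
  then obtain f w where h: "b = f * d ^ n + w" "f \<in> M" "w \<in> opdeg_lt n" by auto
  then show ?case
    using Suc by (cases "f = 0") (auto simp: less_Suc_eq)
qed simp

text \<open>Pseudo-division by an element of minimal order in \<open>\<delta>\<close>: multiplying by leading
  coefficients instead of dividing by them costs exactly the factor allowed in the saturation.\<close>

lemma lideal_between:
  assumes I: "lideal I"
  shows "\<exists>a\<in>I. I \<subseteq> saturation a"
proof (cases "I = {0}")
  case True
  then show ?thesis using zero_in_saturation by auto
next
  case False
  define P where "P n \<longleftrightarrow> (\<exists>a\<in>I. \<exists>f\<in>M. f \<noteq> 0 \<and> (\<exists>w\<in>opdeg_lt n. a = f * d ^ n + w))" for n
  from False I obtain b where b: "b \<in> I" "b \<noteq> 0" "b \<in> R" by (auto simp: lideal_def)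
  obtain k where "b \<in> opdeg_lt k" using R_opdeg_lt[OF b(3)] .
  with b have "\<exists>n. P n" unfolding P_def using opdeg_lt_leading by blast
  define n where "n = (LEAST n. P n)"
  have "P n" unfolding n_def using \<open>\<exists>n. P n\<close> by (rule LeastI_ex)
  then obtain a f w where a: "a \<in> I" "f \<in> M" "f \<noteq> 0" "w \<in> opdeg_lt n" "a = f * d ^ n + w"
    unfolding P_def by auto
  have "b \<in> saturation a" if "b \<in> I" "b \<in> opdeg_lt k" for b k
    using that
  proof (induction k arbitrary: b)
    case 0
    then show ?case by (simp add: zero_in_saturation)
  next
    case (Suc k)
    then obtain g u where b: "b = g * d ^ k + u" "g \<in> M" "u \<in> opdeg_lt k" by auto
    have bR: "b \<in> R" using Suc I by (auto simp: lideal_def)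
    show ?case
    proof (cases "g = 0")
      case True
      then show ?thesis using Suc b by simp
    next
      case False
      then have "P k" using b Suc.prems by (auto simp: P_def)
      then have "n \<le> k" unfolding n_def by (rule Least_le)
      then obtain j where k: "k = n + j" by (auto simp: le_iff_add)
      \<comment> \<open>By minimality of \<open>n\<close>, \<open>b\<close> has order
        \<open>k = n + j\<close>, and \<open>d^j\<close> lifts \<open>a\<close> to that order with
        leading coefficient still \<open>f\<close>.\<close>
      obtain w' where w': "w' \<in> opdeg_lt k" "d ^ j * a = f * d ^ k + w'"
        using power_mult_leading[OF a(2,4), of j] a(5) k by auto
      \<comment> \<open>The difference \<open>f * g - g * f\<close> is kept explicit: this step uses
        ring laws only, and commutativity of M removes the leading term in the next one.\<close>
      have "f * b - g * (d ^ j * a) = f * u - g * w' + (f * g - g * f) * d ^ k"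
        unfolding b(1) w'(2) by (simp add: algebra_simps)
      then have "f * b - g * (d ^ j * a) = f * u - g * w'"
        using M_commute[OF a(2) b(2)] by simp
      moreover have "f * u - g * w' \<in> opdeg_lt k"
        by (intro opdeg_lt_diff opdeg_lt_M_mult a b w')
      moreover have "f * b - g * (d ^ j * a) \<in> I"
        by (intro lideal_diff lideal_R_mult I R_power a Suc.prems M_R b)
      ultimately have "f * b - g * (d ^ j * a) \<in> saturation a" using Suc.IH by simp
      then obtain h q where h: "h \<in> M" "h \<noteq> 0" "q \<in> R" "h * (f * b - g * (d ^ j * a)) = q * a"
        by (auto simp: saturation_def)
      \<comment> \<open>A denominator \<open>h\<close> of the remainder gives the denominator
        \<open>h * f\<close> of \<open>b\<close>.\<close>
      have "h * f * b = (q + h * g * d ^ j) * a"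
        using h(4) by (simp add: algebra_simps)
      then show ?thesis
        using h a b bR
        by (intro saturationI[of _ "h * f" "q + h * g * d ^ j"] M_mult M_nonzero R_add R_mult R_power)
           (auto intro: M_R)
    qed
  qed
  moreover have "\<exists>k. b \<in> opdeg_lt k" if "b \<in> I" for b
    using that I R_opdeg_lt[of b] unfolding lideal_def by (metis subsetD)
  ultimately show ?thesis using a(1) by blast
qed

end

section \<open>The ring of operators on H\<close>

definition hplus :: "hel \<Rightarrow> hel \<Rightarrow> hel" where
  "hplus \<phi> \<psi> = (\<lambda>m z. \<phi> m z + \<psi> m z)"

lemma HsetI:
  assumes "finite {n. \<phi> n \<noteq> (\<lambda>_. 0)}" "\<And>n. \<phi> n holomorphic_on UHP" "\<And>n z. z \<notin> UHP \<Longrightarrow> \<phi> n z = 0"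
  shows "\<phi> \<in> Hset"
  using assms by (simp add: Hset_def)

lemma HsetD:
  assumes "\<phi> \<in> Hset"
  shows "finite {n. \<phi> n \<noteq> (\<lambda>_. 0)}" "\<phi> n holomorphic_on UHP" "z \<notin> UHP \<Longrightarrow> \<phi> n z = 0"
  using assms by (simp_all add: Hset_def)

lemma Hset_hzero: "hzero \<in> Hset"
  by (rule HsetI) (auto simp: hzero_def)

lemma Hset_hplus:
  assumes "\<phi> \<in> Hset" "\<psi> \<in> Hset"
  shows "hplus \<phi> \<psi> \<in> Hset"
proof (rule HsetI)
  have "{n. hplus \<phi> \<psi> n \<noteq> (\<lambda>_. 0)} \<subseteq> {n. \<phi> n \<noteq> (\<lambda>_. 0)} \<union> {n. \<psi> n \<noteq> (\<lambda>_. 0)}"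
    by (auto simp: hplus_def)
  then show "finite {n. hplus \<phi> \<psi> n \<noteq> (\<lambda>_. 0)}"
    by (rule finite_subset) (simp add: HsetD assms)
qed (auto simp: hplus_def HsetD assms intro!: holomorphic_intros)

lemma finite_support_shift:
  assumes "\<phi> \<in> Hset" "\<And>m. \<phi> (m - k) = (\<lambda>_. 0) \<Longrightarrow> \<psi> m = (\<lambda>_. 0)"
  shows "finite {m. \<psi> m \<noteq> (\<lambda>_. 0)}"
proof (rule finite_subset)
  show "{m. \<psi> m \<noteq> (\<lambda>_. 0)} \<subseteq> (\<lambda>n. n + k) ` {n. \<phi> n \<noteq> (\<lambda>_. 0)}"
  proof
    fix m assume "m \<in> {m. \<psi> m \<noteq> (\<lambda>_. 0)}"
    then have "m - k \<in> {n. \<phi> n \<noteq> (\<lambda>_. 0)}" using assms(2) by auto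
    then show "m \<in> (\<lambda>n. n + k) ` {n. \<phi> n \<noteq> (\<lambda>_. 0)}"
      by (rule rev_image_eqI) simp
  qed
qed (simp add: HsetD assms)

lemma Hset_shift_mult:
  assumes "\<phi> \<in> Hset" "f holomorphic_on UHP"
  shows "(\<lambda>m z. f z * \<phi> (m - k) z) \<in> Hset"
  by (rule HsetI, rule finite_support_shift[OF assms(1), of k])
     (auto simp: HsetD assms intro!: holomorphic_intros)

lemma serre_hplus:
  assumes "f holomorphic_on UHP" "g holomorphic_on UHP" "z \<in> UHP"
  shows "serre k (\<lambda>z. f z + g z) z = serre k f z + serre k g z"
proof -
  have "f field_differentiable (at z)" "g field_differentiable (at z)"
    using assms open_UHP by (auto intro: holomorphic_on_imp_differentiable_at)
  then show ?thesis
    by (simp add: serre_def nderiv_def add_divide_distrib algebra_simps)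
qed

text \<open>Since the weights add, the \<open>E2\<close> term splits between the two
  factors.\<close>

lemma serre_mult:
  assumes "f holomorphic_on UHP" "g holomorphic_on UHP" "z \<in> UHP"
  shows "serre (k + l) (\<lambda>z. f z * g z) z = serre k f z * g z + f z * serre l g z"
proof -
  have "f field_differentiable (at z)" "g field_differentiable (at z)"
    using assms open_UHP by (auto intro: holomorphic_on_imp_differentiable_at)
  then show ?thesis
    by (simp add: serre_def nderiv_def add_divide_distrib algebra_simps)
qed

lemma Hset_delta:
  assumes "\<phi> \<in> Hset"
  shows "delta \<phi> \<in> Hset"
proof (rule HsetI)
  show "finite {m. delta \<phi> m \<noteq> (\<lambda>_. 0)}"
    by (rule finite_support_shift[OF assms, of 2], rule ext) (simp add: delta_def assms serre_def nderiv_def)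
  fix n
  have "(\<lambda>z. serre (n - 2) (\<phi> (n - 2)) z) holomorphic_on UHP"
    unfolding serre_def nderiv_def
    by (intro holomorphic_intros holomorphic_deriv open_UHP HsetD[OF assms] holomorphic_E2) auto
  then show "delta \<phi> n holomorphic_on UHP"
    by (rule holomorphic_transform) (simp add: delta_def assms)
qed (simp add: delta_def assms)

section \<open>Additive endomorphisms of H as a ring\<close>

definition end_op :: "hop \<Rightarrow> bool" where
  "end_op T \<longleftrightarrow> T \<in> extensional Hset \<and> (\<forall>\<phi>\<in>Hset. T \<phi> \<in> Hset) \<and>
    (\<forall>\<phi>\<in>Hset. \<forall>\<psi>\<in>Hset. T (hplus \<phi> \<psi>) = hplus (T \<phi>) (T \<psi>))"

lemma end_op_Hset: "end_op T \<Longrightarrow> \<phi> \<in> Hset \<Longrightarrow> T \<phi> \<in> Hset"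
  by (simp add: end_op_def)

lemma end_op_hplus: "end_op T \<Longrightarrow> \<phi> \<in> Hset \<Longrightarrow> \<psi> \<in> Hset \<Longrightarrow> T (hplus \<phi> \<psi>) = hplus (T \<phi>) (T \<psi>)"
  by (simp add: end_op_def)

lemma end_op_eqI:
  assumes "end_op S" "end_op T" "\<And>\<phi>. \<phi> \<in> Hset \<Longrightarrow> S \<phi> = T \<phi>"
  shows "S = T"
  using assms by (auto simp: end_op_def intro: extensionalityI)

lemma end_op_shift_mult:
  assumes "f holomorphic_on UHP"
  shows "end_op (restrict (\<lambda>\<phi> m z. f z * \<phi> (m - k) z) Hset)"
  by (auto simp: end_op_def Hset_shift_mult assms Hset_hplus) (simp add: hplus_def distrib_left)

lemma end_op_e4op: "end_op e4op"
  unfolding e4op_def by (rule end_op_shift_mult[OF holomorphic_E4])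

lemma end_op_e6op: "end_op e6op"
  unfolding e6op_def by (rule end_op_shift_mult[OF holomorphic_E6])

lemma end_op_scalop: "end_op (scalop c)"
  using end_op_shift_mult[of "\<lambda>_. c" 0] by (simp add: scalop_def)

lemma end_op_delta: "end_op delta"
proof -
  have "delta (hplus \<phi> \<psi>) = hplus (delta \<phi>) (delta \<psi>)" if "\<phi> \<in> Hset" "\<psi> \<in> Hset" for \<phi> \<psi>
    using that Hset_hplus[OF that] by (auto simp: delta_def hplus_def serre_hplus[OF HsetD(2) HsetD(2)] fun_eq_iff)
  then show ?thesis
    by (auto simp: end_op_def Hset_delta) (simp add: delta_def)
qed

lemma end_op_opadd:
  assumes "end_op S" "end_op T"
  shows "end_op (opadd S T)"
proof -
  have "opadd S T \<phi> = hplus (S \<phi>) (T \<phi>)" if "\<phi> \<in> Hset" for \<phi>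
    using that by (simp add: opadd_def hplus_def)
  then show ?thesis using assms
    by (auto simp: end_op_def Hset_hplus opadd_def[of S T]) (simp add: hplus_def add_ac)
qed

lemma end_op_opmult:
  assumes "end_op S" "end_op T"
  shows "end_op (opmult S T)"
  using assms by (auto simp: end_op_def opmult_def Hset_hplus)

lemma end_op_opzero: "end_op opzero"
  by (auto simp: end_op_def opzero_def Hset_hzero Hset_hplus) (simp add: hzero_def hplus_def)

lemmas end_op_intros = end_op_scalop end_op_delta end_op_e4op end_op_e6op end_op_opadd end_op_opmult
  end_op_opzero

lemma end_op_Ralg: "a \<in> Ralg \<Longrightarrow> end_op a"
  by (induction rule: Ralg.induct) (auto intro: end_op_intros)

lemma Malg_Ralg: "a \<in> Malg \<Longrightarrow> a \<in> Ralg"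
  by (induction rule: Malg.induct) (auto intro: Ralg.intros)

lemma end_op_Malg: "a \<in> Malg \<Longrightarrow> end_op a"
  by (intro end_op_Ralg Malg_Ralg)

lemma scalop_apply: "\<phi> \<in> Hset \<Longrightarrow> scalop c \<phi> m z = c * \<phi> m z"
  and e4op_apply: "\<phi> \<in> Hset \<Longrightarrow> e4op \<phi> m z = E4 z * \<phi> (m - 4) z"
  and e6op_apply: "\<phi> \<in> Hset \<Longrightarrow> e6op \<phi> m z = E6 z * \<phi> (m - 6) z"
  and opadd_apply: "\<phi> \<in> Hset \<Longrightarrow> opadd S T \<phi> m z = S \<phi> m z + T \<phi> m z"
  and opmult_apply: "\<phi> \<in> Hset \<Longrightarrow> opmult S T \<phi> = S (T \<phi>)"
  and opzero_apply: "\<phi> \<in> Hset \<Longrightarrow> opzero \<phi> = hzero"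
  by (simp_all add: scalop_def e4op_def e6op_def opadd_def opmult_def opzero_def)

text \<open>This puts zero into both \<open>Malg\<close> and \<open>Ralg\<close>, whose generators
  include the scalars.\<close>

lemma opzero_eq: "opzero = scalop 0"
  by (rule end_op_eqI) (auto intro: end_op_intros simp: opzero_apply hzero_def scalop_apply fun_eq_iff)

text \<open>The type carries the ring calculus for operators. Additivity provides left
  distributivity, and extensionality turns equality on \<open>Hset\<close> into equality of
  functions.\<close>

typedef hend = "{T. end_op T}"
  using end_op_opzero by blast

setup_lifting type_definition_hend

lemma end_op_Rep: "end_op (Rep_hend x)"
  using Rep_hend by simp

lemmas end_op_apply = scalop_apply opadd_apply opmult_apply opzero_apply end_op_Hset

instantiation hend :: ring_1
begin

lift_definition zero_hend :: hend is opzero by (rule end_op_opzero)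
lift_definition one_hend :: hend is "scalop 1" by (rule end_op_scalop)
lift_definition plus_hend :: "hend \<Rightarrow> hend \<Rightarrow> hend" is opadd by (rule end_op_opadd)
lift_definition times_hend :: "hend \<Rightarrow> hend \<Rightarrow> hend" is opmult by (rule end_op_opmult)
text \<open>Negation is composition with the scalar -1, so \<open>Malg\<close> and
  \<open>Ralg\<close> are closed under it because they are closed under
  \<open>opmult\<close>.\<close>

lift_definition uminus_hend :: "hend \<Rightarrow> hend" is "opmult (scalop (- 1))"
  by (rule end_op_opmult[OF end_op_scalop])
definition minus_hend :: "hend \<Rightarrow> hend \<Rightarrow> hend" where "minus_hend x y = x + - y"

instance
proof
  fix a b c :: hend
  show "a + b + c = a + (b + c)"
    by transfer (rule end_op_eqI; auto intro!: end_op_intros simp: end_op_apply fun_eq_iff)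
  show "a + b = b + a"
    by transfer (rule end_op_eqI; auto intro!: end_op_intros simp: end_op_apply fun_eq_iff)
  show "0 + a = a"
    by transfer (rule end_op_eqI; auto intro!: end_op_intros simp: end_op_apply fun_eq_iff hzero_def)
  show "- a + a = 0"
    by transfer (rule end_op_eqI; auto intro!: end_op_intros simp: end_op_apply fun_eq_iff hzero_def)
  show "a - b = a + - b" by (simp add: minus_hend_def)
  show "a * b * c = a * (b * c)"
    by transfer (rule end_op_eqI; auto intro!: end_op_intros simp: end_op_apply)
  show "1 * a = a"
    by transfer (rule end_op_eqI; auto intro!: end_op_intros simp: end_op_apply fun_eq_iff)
  show "a * 1 = a"
  proof transfer
    fix a assume "end_op a"
    moreover have "scalop 1 \<phi> = \<phi>" if "\<phi> \<in> Hset" for \<phi>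
      using that by (simp add: scalop_apply fun_eq_iff)
    ultimately show "opmult a (scalop 1) = a"
      by (intro end_op_eqI) (auto intro!: end_op_intros simp: opmult_apply)
  qed
  show "(a + b) * c = a * c + b * c"
    by transfer (rule end_op_eqI; auto intro!: end_op_intros simp: end_op_apply fun_eq_iff)
  show "a * (b + c) = a * b + a * c"
  proof transfer
    fix a b c assume *: "end_op a" "end_op b" "end_op c"
    have "opmult a (opadd b c) \<phi> = opadd (opmult a b) (opmult a c) \<phi>" if \<phi>: "\<phi> \<in> Hset" for \<phi>
    proof -
      have "opadd b c \<phi> = hplus (b \<phi>) (c \<phi>)" using \<phi> by (simp add: opadd_apply hplus_def fun_eq_iff)
      then have "opmult a (opadd b c) \<phi> = hplus (a (b \<phi>)) (a (c \<phi>))"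
        using \<phi> * by (simp add: opmult_apply end_op_hplus end_op_Hset)
      then show ?thesis using \<phi> by (simp add: opadd_apply opmult_apply hplus_def fun_eq_iff)
    qed
    then show "opmult a (opadd b c) = opadd (opmult a b) (opmult a c)" using *
      by (intro end_op_eqI end_op_intros)
  qed
  show "(0::hend) \<noteq> 1"
  proof transfer
    \<comment> \<open>The constant function 1 in weight 0 separates the zero operator from the
      identity.\<close>
    define \<phi> :: hel where "\<phi> = (\<lambda>n z. if n = 0 \<and> z \<in> UHP then 1 else 0)"
    have "\<phi> \<in> Hset"
    proof (rule HsetI)
      have "{n. \<phi> n \<noteq> (\<lambda>_. 0)} \<subseteq> {0}" by (auto simp: \<phi>_def)
      then show "finite {n. \<phi> n \<noteq> (\<lambda>_. 0)}" by (rule finite_subset) simp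
      show "\<phi> n holomorphic_on UHP" for n
        by (rule holomorphic_transform[of "\<lambda>_. if n = 0 then 1 else 0"]) (auto simp: \<phi>_def)
    qed (simp add: \<phi>_def)
    moreover have "\<phi> 0 \<i> = 1" by (simp add: \<phi>_def UHP_def)
    ultimately have "opzero \<phi> 0 \<i> \<noteq> scalop 1 \<phi> 0 \<i>"
      by (simp add: end_op_apply hzero_def)
    then show "opzero \<noteq> scalop 1" by metis
  qed
qed

end

section \<open>Elements of M as polynomials in the weight shift; torsion-freeness of H\<close>

lemma holomorphic_mult_eq_0:
  assumes "f holomorphic_on UHP" "g holomorphic_on UHP" "\<And>z. z \<in> UHP \<Longrightarrow> f z * g z = 0"
    and w: "w \<in> UHP" "f w \<noteq> 0" and z: "z \<in> UHP"
  shows "g z = 0"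
proof -
  let ?S = "{z\<in>UHP. f z \<noteq> 0}"
  have "?S = UHP \<inter> f -` (- {0})" by auto
  moreover have "open (UHP \<inter> f -` (- {0}))"
    by (intro continuous_open_preimage holomorphic_on_imp_continuous_on assms open_UHP) auto
  ultimately have "open ?S" by simp
  \<comment> \<open>The function \<open>g\<close> vanishes on the nonempty open set where
    \<open>f\<close> does not, hence everywhere by the identity theorem.\<close>
  then show ?thesis
    by (rule analytic_continuation_open[OF _ open_UHP _ connected_UHP _ assms(2) _ _ z, where g = "\<lambda>_. 0"])
       (use w assms(3) in auto)
qed

text \<open>Multiplication by an inhomogeneous form whose component of weight \<open>k\<close> is
  \<open>c k\<close>. The weights in H are real, but those occurring in M are natural
  numbers.\<close>

definition poly_op :: "hop \<Rightarrow> (nat \<Rightarrow> complex \<Rightarrow> complex) \<Rightarrow> nat \<Rightarrow> bool" where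
  "poly_op T c N \<longleftrightarrow> (\<forall>k. c k holomorphic_on UHP) \<and> (\<forall>k>N. c k = (\<lambda>_. 0)) \<and>
    (\<forall>\<phi>\<in>Hset. \<forall>m z. T \<phi> m z = (\<Sum>k\<le>N. c k z * \<phi> (m - real k) z))"

lemma poly_op_mono:
  assumes "poly_op T c N" "N \<le> N'"
  shows "poly_op T c N'"
proof -
  have "(\<Sum>k\<le>N. c k z * \<phi> (m - real k) z) = (\<Sum>k\<le>N'. c k z * \<phi> (m - real k) z)" for \<phi> :: hel and m z
    using assms by (intro sum.mono_neutral_left) (auto simp: poly_op_def)
  with assms show ?thesis by (auto simp: poly_op_def)
qed

lemma poly_op_add:
  assumes "poly_op S c N" "poly_op T d N'"
  shows "\<exists>e N. poly_op (opadd S T) e N"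
proof -
  have "poly_op S c (max N N')" "poly_op T d (max N N')"
    using assms by (auto elim: poly_op_mono)
  then have "poly_op (opadd S T) (\<lambda>k z. c k z + d k z) (max N N')"
    by (auto simp: poly_op_def opadd_apply distrib_right sum.distrib intro!: holomorphic_intros)
  then show ?thesis by blast
qed

text \<open>The generators of M are the cases \<open>s = 0\<close>, \<open>s = 4\<close> and
  \<open>s = 6\<close>; composing with one of them moves the coefficient at \<open>k\<close> to
  \<open>k + s\<close>.\<close>

lemma poly_op_shift:
  assumes T: "poly_op T c N" "end_op T" and f: "f holomorphic_on UHP"
    and S: "\<And>\<phi> m z. \<phi> \<in> Hset \<Longrightarrow> S \<phi> m z = f z * \<phi> (m - real s) z"
  shows "\<exists>d N. poly_op (opmult S T) d N"
proof -
  define d where "d k = (if k < s then (\<lambda>_. 0) else (\<lambda>z. f z * c (k - s) z))" for k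
  have "opmult S T \<phi> m z = (\<Sum>k\<le>N + s. d k z * \<phi> (m - real k) z)" if "\<phi> \<in> Hset" for \<phi> m z
  proof -
    have "opmult S T \<phi> m z = (\<Sum>k\<le>N. f z * c k z * \<phi> (m - real s - real k) z)"
      using T that by (simp add: opmult_apply S end_op_Hset poly_op_def sum_distrib_left mult_ac)
    also have "\<dots> = (\<Sum>k\<in>{s..N + s}. d k z * \<phi> (m - real k) z)"
      by (rule sum.reindex_bij_witness[where i = "\<lambda>k. k - s" and j = "\<lambda>k. k + s"])
         (auto simp: d_def algebra_simps)
    also have "\<dots> = (\<Sum>k\<le>N + s. d k z * \<phi> (m - real k) z)"
      by (rule sum.mono_neutral_left) (auto simp: d_def)
    finally show ?thesis .
  qed
  moreover have "\<forall>k. d k holomorphic_on UHP"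
    using T f by (auto simp: d_def poly_op_def intro!: holomorphic_intros)
  moreover have "\<forall>k>N + s. d k = (\<lambda>_. 0)"
    using T by (auto simp: d_def poly_op_def)
  ultimately have "poly_op (opmult S T) d (N + s)" by (simp add: poly_op_def)
  then show ?thesis by blast
qed

text \<open>The right factor \<open>b\<close> is arbitrary so that a product in M is handled by
  associativity: only generators are ever composed with a \<open>poly_op\<close>.\<close>

lemma Malg_poly_op_mult:
  assumes "a \<in> Malg" "end_op b" "\<exists>c N. poly_op b c N"
  shows "\<exists>c N. poly_op (opmult a b) c N"
  using assms
proof (induction arbitrary: b rule: Malg.induct)
  case (scal s)
  then show ?case
    using poly_op_shift[where f = "\<lambda>_. s" and S = "scalop s" and s = 0 and T = b] by (auto simp: scalop_apply)
next
  case e4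
  then show ?case
    using poly_op_shift[OF _ _ holomorphic_E4, where S = e4op and s = 4 and T = b] by (auto simp: e4op_apply)
next
  case e6
  then show ?case
    using poly_op_shift[OF _ _ holomorphic_E6, where S = e6op and s = 6 and T = b] by (auto simp: e6op_apply)
next
  case (add a a')
  have "opmult (opadd a a') b = opadd (opmult a b) (opmult a' b)"
    using add by (intro end_op_eqI)
      (auto intro!: end_op_intros simp: end_op_Malg end_op_apply fun_eq_iff)
  moreover obtain c N d N' where "poly_op (opmult a b) c N" "poly_op (opmult a' b) d N'"
    using add by blast
  ultimately show ?case using poly_op_add by simp
next
  case (mult a a')
  have "opmult (opmult a a') b = opmult a (opmult a' b)"
    using mult by (intro end_op_eqI)
      (auto intro!: end_op_intros simp: end_op_Malg end_op_apply)
  then show ?case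
    using mult.IH(1)[OF end_op_opmult[OF end_op_Malg[OF mult.hyps(2)] mult.prems(1)]] mult.IH(2) mult.prems
    by simp
qed

lemma Malg_poly_op:
  assumes "a \<in> Malg"
  obtains c N where "poly_op a c N"
proof -
  have "poly_op (scalop 1) (\<lambda>k _. if k = 0 then 1 else 0) 0"
    by (auto simp: poly_op_def scalop_apply)
  moreover have "opmult a (scalop 1) = a"
  proof -
    have "scalop 1 \<phi> = \<phi>" if "\<phi> \<in> Hset" for \<phi>
      using that by (simp add: scalop_apply fun_eq_iff)
    then show ?thesis
      by (intro end_op_eqI)
        (auto intro!: end_op_intros simp: end_op_Malg[OF assms] opmult_apply)
  qed
  ultimately show ?thesis
    using Malg_poly_op_mult[OF assms end_op_scalop, of 1] that by metis
qed

text \<open>Both products are the same double sum, since coefficients multiply pointwise and weight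
  shifts add.\<close>

lemma Malg_commute:
  assumes "a \<in> Malg" "b \<in> Malg"
  shows "opmult a b = opmult b a"
proof (rule end_op_eqI)
  show "end_op (opmult a b)" "end_op (opmult b a)"
    using assms by (simp_all add: end_op_opmult end_op_Malg)
  fix \<phi> assume \<phi>: "\<phi> \<in> Hset"
  then have ab: "a \<phi> \<in> Hset" "b \<phi> \<in> Hset"
    using assms by (simp_all add: end_op_Hset[OF end_op_Malg])
  obtain c N where c: "poly_op a c N" using Malg_poly_op[OF assms(1)] .
  obtain d N' where d: "poly_op b d N'" using Malg_poly_op[OF assms(2)] .
  have "a (b \<phi>) m z = b (a \<phi>) m z" for m z
  proof -
    have "a (b \<phi>) m z = (\<Sum>k\<le>N. \<Sum>l\<le>N'. c k z * (d l z * \<phi> (m - real k - real l) z))"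
      using c d \<phi> ab by (simp add: poly_op_def sum_distrib_left)
    also have "\<dots> = (\<Sum>l\<le>N'. \<Sum>k\<le>N. d l z * (c k z * \<phi> (m - real l - real k) z))"
      by (subst sum.swap) (simp add: algebra_simps)
    also have "\<dots> = b (a \<phi>) m z"
      using c d \<phi> ab by (simp add: poly_op_def sum_distrib_left)
    finally show ?thesis .
  qed
  then show "opmult a b \<phi> = opmult b a \<phi>"
    using \<phi> by (simp add: opmult_apply fun_eq_iff)
qed

text \<open>The top weight component of \<open>a \<psi>\<close> is the product of those of \<open>a\<close> and \<open>\<psi>\<close>.\<close>

lemma Malg_torsion_free:
  assumes a: "a \<in> Malg" "a \<noteq> opzero" and \<psi>: "\<psi> \<in> Hset" and eq: "a \<psi> = hzero"
  shows "\<psi> = hzero"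
proof (rule ccontr)
  assume "\<psi> \<noteq> hzero"
  then have ne: "{n. \<psi> n \<noteq> (\<lambda>_. 0)} \<noteq> {}" by (auto simp: hzero_def)
  define l where "l = Max {n. \<psi> n \<noteq> (\<lambda>_. 0)}"
  have l: "\<psi> l \<noteq> (\<lambda>_. 0)" using Max_in[OF HsetD(1)[OF \<psi>] ne] by (simp add: l_def)
  have l_max: "\<psi> n = (\<lambda>_. 0)" if "l < n" for n
    using Max_ge[OF HsetD(1)[OF \<psi>], of n] that unfolding l_def[symmetric] by auto
  obtain c N where c: "poly_op a c N" using Malg_poly_op[OF a(1)] .
  \<comment> \<open>Vanishing is tested on \<open>UHP\<close> only: elsewhere \<open>c k\<close> is
    arbitrary, but every element of \<open>Hset\<close> is zero there.\<close>
  define K where "K = {k. k \<le> N \<and> (\<exists>z\<in>UHP. c k z \<noteq> 0)}"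
  have "K \<noteq> {}"
  proof
    assume "K = {}"
    then have zero: "c k z = 0" if "k \<le> N" "z \<in> UHP" for k z using that by (auto simp: K_def)
    have "a \<phi> m z = 0" if "\<phi> \<in> Hset" for \<phi> m z
      using c that zero[of _ z] HsetD(3)[OF that, of z]
      by (cases "z \<in> UHP") (auto simp: poly_op_def intro!: sum.neutral)
    then have "a = opzero"
      by (intro end_op_eqI) (auto intro!: end_op_opzero end_op_Malg a
          simp: opzero_apply hzero_def fun_eq_iff)
    with a show False by simp
  qed
  have "finite K" by (simp add: K_def)
  define k where "k = Max K"
  have "k \<in> K" unfolding k_def by (rule Max_in) fact+
  then obtain w where w: "k \<le> N" "w \<in> UHP" "c k w \<noteq> 0" by (auto simp: K_def)
  have k_max: "c j z = 0" if "k < j" "j \<le> N" "z \<in> UHP" for j z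
    using Max_ge[OF \<open>finite K\<close>, of j] that unfolding k_def[symmetric] by (auto simp: K_def)
  have "c k z * \<psi> l z = 0" if z: "z \<in> UHP" for z
  proof -
    have "0 = (\<Sum>j\<le>N. c j z * \<psi> (l + real k - real j) z)"
      using c \<psi> eq unfolding poly_op_def by (metis hzero_def)
    also have "\<dots> = (\<Sum>j\<in>{k}. c j z * \<psi> (l + real k - real j) z)"
    \<comment> \<open>In weight \<open>l + k\<close>, a term with \<open>j > k\<close> has
      coefficient zero by the choice of \<open>k\<close>, and one with \<open>j < k\<close> meets
      \<open>\<psi>\<close> above its top weight \<open>l\<close>.\<close>
    proof (rule sum.mono_neutral_right)
      show "\<forall>j\<in>{..N} - {k}. c j z * \<psi> (l + real k - real j) z = 0"
      proof
        fix j assume "j \<in> {..N} - {k}"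
        then consider "k < j" "j \<le> N" | "j < k" by fastforce
        then show "c j z * \<psi> (l + real k - real j) z = 0"
          by cases (use k_max z l_max[of "l + real k - real j"] in auto)
      qed
    qed (use w in auto)
    finally show ?thesis by simp
  qed
  then have "\<psi> l z = 0" if "z \<in> UHP" for z
    using holomorphic_mult_eq_0[of "c k" "\<psi> l" w z] c HsetD(2)[OF \<psi>] w that by (auto simp: poly_op_def)
  then have "\<psi> l = (\<lambda>_. 0)"
    using HsetD(3)[OF \<psi>] by (metis ext)
  with l show False by simp
qed

section \<open>Commutators of \<open>delta\<close> with the generators of M\<close>

lemma delta_apply: "\<phi> \<in> Hset \<Longrightarrow> delta \<phi> m z = (if z \<in> UHP then serre (m - 2) (\<phi> (m - 2)) z else 0)"
  by (simp add: delta_def)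

lemma delta_scalop: "opmult delta (scalop c) = opmult (scalop c) delta"
proof (rule end_op_eqI)
  fix \<phi> assume \<phi>: "\<phi> \<in> Hset"
  have sc: "scalop c \<phi> \<in> Hset" by (rule end_op_Hset[OF end_op_scalop \<phi>])
  have "serre k (scalop c \<phi> n) z = c * serre k (\<phi> n) z" if "z \<in> UHP" for k n z
  proof -
    have "scalop c \<phi> n = (\<lambda>z. c * \<phi> n z)" using \<phi> by (simp add: scalop_apply fun_eq_iff)
    \<comment> \<open>A constant counts as a form of weight 0, and its Serre derivative
      vanishes.\<close>
    moreover have "serre k (\<lambda>z. c * \<phi> n z) z = serre 0 (\<lambda>_. c) z * \<phi> n z + c * serre k (\<phi> n) z"
      using serre_mult[of "\<lambda>_. c" "\<phi> n" z 0 k] HsetD(2)[OF \<phi>] that by simp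
    ultimately show ?thesis by (simp add: serre_def nderiv_def)
  qed
  then show "opmult delta (scalop c) \<phi> = opmult (scalop c) delta \<phi>"
    using \<phi> sc by (auto simp: opmult_apply delta_apply scalop_apply Hset_delta fun_eq_iff)
qed (intro end_op_intros)+

text \<open>Leibniz rule for the splitting \<open>m - 2 = 4 + (m - 6)\<close> of the weight;
  Ramanujan's identity evaluates the term where \<open>E4\<close> is differentiated.\<close>

lemma delta_e4op:
  "opmult delta e4op = opadd (opmult e4op delta) (opmult (scalop (- 1 / 3)) e6op)"
proof (rule end_op_eqI)
  fix \<phi> assume \<phi>: "\<phi> \<in> Hset"
  note h = end_op_Hset[OF end_op_e4op \<phi>] end_op_Hset[OF end_op_e6op \<phi>]
  have eq: "serre (m - 2) (e4op \<phi> (m - 2)) z = E4 z * serre (m - 6) (\<phi> (m - 6)) z - E6 z * \<phi> (m - 6) z / 3"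
    if z: "z \<in> UHP" for m z
  proof -
    have "e4op \<phi> (m - 2) = (\<lambda>z. E4 z * \<phi> (m - 6) z)" using \<phi> by (simp add: e4op_apply fun_eq_iff)
    then show ?thesis
      using serre_mult[OF holomorphic_E4 HsetD(2)[OF \<phi>] z, of 4 "m - 6" "m - 6"]
      by (simp add: ramanujan_E4[OF z])
  qed
  have "opmult delta e4op \<phi> m z = opadd (opmult e4op delta) (opmult (scalop (- 1 / 3)) e6op) \<phi> m z" for m z
    using \<phi> h eq[of z m] HsetD(3)[OF \<phi>, of z]
    by (simp add: opmult_apply opadd_apply delta_apply scalop_apply e4op_apply e6op_apply Hset_delta)
  then show "opmult delta e4op \<phi> = opadd (opmult e4op delta) (opmult (scalop (- 1 / 3)) e6op) \<phi>"
    by (simp add: fun_eq_iff)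
qed (intro end_op_intros)+

lemma delta_e6op:
  "opmult delta e6op = opadd (opmult e6op delta) (opmult (scalop (- 1 / 2)) (opmult e4op e4op))"
proof (rule end_op_eqI)
  fix \<phi> assume \<phi>: "\<phi> \<in> Hset"
  note h = end_op_Hset[OF end_op_e4op \<phi>] end_op_Hset[OF end_op_e6op \<phi>]
    end_op_Hset[OF end_op_e4op end_op_Hset[OF end_op_e4op \<phi>]]
  have eq: "serre (m - 2) (e6op \<phi> (m - 2)) z = E6 z * serre (m - 8) (\<phi> (m - 8)) z - E4 z ^ 2 * \<phi> (m - 8) z / 2"
    if z: "z \<in> UHP" for m z
  proof -
    have "e6op \<phi> (m - 2) = (\<lambda>z. E6 z * \<phi> (m - 8) z)" using \<phi> by (simp add: e6op_apply fun_eq_iff)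
    then show ?thesis
      using serre_mult[OF holomorphic_E6 HsetD(2)[OF \<phi>] z, of 6 "m - 8" "m - 8"]
      by (simp add: ramanujan_E6[OF z])
  qed
  have "opmult delta e6op \<phi> m z =
      opadd (opmult e6op delta) (opmult (scalop (- 1 / 2)) (opmult e4op e4op)) \<phi> m z" for m z
    using \<phi> h eq[of z m] HsetD(3)[OF \<phi>, of z]
    by (simp add: opmult_apply opadd_apply delta_apply scalop_apply Hset_delta)
       (simp add: e4op_apply e6op_apply delta_apply Hset_delta power2_eq_square)
  then show "opmult delta e6op \<phi> =
      opadd (opmult e6op delta) (opmult (scalop (- 1 / 2)) (opmult e4op e4op)) \<phi>"
    by (simp add: fun_eq_iff)
qed (intro end_op_intros)+

section \<open>Left ideals and annihilators in R\<close>

definition R_hend :: "hend set" where "R_hend = {x. Rep_hend x \<in> Ralg}"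
definition M_hend :: "hend set" where "M_hend = {x. Rep_hend x \<in> Malg}"

lemma Rep_Abs_hend: "end_op T \<Longrightarrow> Rep_hend (Abs_hend T) = T"
  by (simp add: Abs_hend_inverse)

lemma hend_eqI: "Rep_hend x = Rep_hend y \<Longrightarrow> x = y"
  by (simp add: Rep_hend_inject)

lemmas hend_rep_eq = zero_hend.rep_eq one_hend.rep_eq plus_hend.rep_eq times_hend.rep_eq uminus_hend.rep_eq

text \<open>The commutator with \<open>delta\<close> is a derivation, so only the generators need a
  computation.\<close>

lemma Malg_delta_commutator:
  assumes "a \<in> Malg"
  shows "Abs_hend delta * Abs_hend a - Abs_hend a * Abs_hend delta \<in> M_hend"
  using assms
proof (induction rule: Malg.induct)
  case (scal c)
  have "Abs_hend delta * Abs_hend (scalop c) = Abs_hend (scalop c) * Abs_hend delta"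
    by (rule hend_eqI) (simp add: hend_rep_eq Rep_Abs_hend end_op_intros delta_scalop)
  then show ?case by (simp add: M_hend_def hend_rep_eq opzero_eq Malg.scal)
next
  case e4
  have "Abs_hend delta * Abs_hend e4op = Abs_hend e4op * Abs_hend delta + Abs_hend (opmult (scalop (- 1 / 3)) e6op)"
    by (rule hend_eqI) (simp only: hend_rep_eq Rep_Abs_hend end_op_intros delta_e4op)
  then show ?case
    by (simp add: M_hend_def Rep_Abs_hend end_op_intros Malg.intros)
next
  case e6
  have "Abs_hend delta * Abs_hend e6op = Abs_hend e6op * Abs_hend delta
      + Abs_hend (opmult (scalop (- 1 / 2)) (opmult e4op e4op))"
    by (rule hend_eqI) (simp only: hend_rep_eq Rep_Abs_hend end_op_intros delta_e6op)
  then show ?case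
    by (simp add: M_hend_def Rep_Abs_hend end_op_intros Malg.intros)
next
  case (add a b)
  have "Abs_hend (opadd a b) = Abs_hend a + Abs_hend b"
    by (rule hend_eqI) (simp add: hend_rep_eq Rep_Abs_hend end_op_opadd end_op_Malg add)
  then have "Abs_hend delta * Abs_hend (opadd a b) - Abs_hend (opadd a b) * Abs_hend delta =
      (Abs_hend delta * Abs_hend a - Abs_hend a * Abs_hend delta)
      + (Abs_hend delta * Abs_hend b - Abs_hend b * Abs_hend delta)"
    by (simp add: algebra_simps)
  then show ?case using add by (simp add: M_hend_def hend_rep_eq Malg.add)
next
  case (mult a b)
  have "Abs_hend (opmult a b) = Abs_hend a * Abs_hend b"
    by (rule hend_eqI) (simp add: hend_rep_eq Rep_Abs_hend end_op_opmult end_op_Malg mult)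
  then have "Abs_hend delta * Abs_hend (opmult a b) - Abs_hend (opmult a b) * Abs_hend delta =
      (Abs_hend delta * Abs_hend a - Abs_hend a * Abs_hend delta) * Abs_hend b
      + Abs_hend a * (Abs_hend delta * Abs_hend b - Abs_hend b * Abs_hend delta)"
    by (simp add: algebra_simps)
  moreover have "Abs_hend a \<in> M_hend" "Abs_hend b \<in> M_hend"
    using mult by (simp_all add: M_hend_def Rep_Abs_hend end_op_Malg)
  ultimately show ?case using mult by (simp add: M_hend_def hend_rep_eq Malg.add Malg.mult)
qed

interpretation Rops: derivation_extension R_hend M_hend "Abs_hend delta"
proof
  show "0 \<in> M_hend" "1 \<in> M_hend" "- 1 \<in> M_hend"
    by (simp_all add: M_hend_def hend_rep_eq opzero_eq Malg.scal Malg.mult)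
  fix f g assume f: "f \<in> M_hend"
  then show "f \<in> R_hend" by (simp add: M_hend_def R_hend_def Malg_Ralg)
  from f show "Abs_hend delta * f - f * Abs_hend delta \<in> M_hend"
    using Malg_delta_commutator[of "Rep_hend f"] by (simp add: M_hend_def Rep_hend_inverse)
  assume g: "g \<in> M_hend"
  show "f + g \<in> M_hend" "f * g \<in> M_hend"
    using f g by (simp_all add: M_hend_def hend_rep_eq Malg.add Malg.mult)
  show "f * g = g * f"
    using f g by (intro hend_eqI) (simp add: M_hend_def hend_rep_eq Malg_commute)
  assume "f \<noteq> 0" "g \<noteq> 0"
  show "f * g \<noteq> 0"
  proof
    assume "f * g = 0"
    then have fg: "opmult (Rep_hend f) (Rep_hend g) = opzero" by (metis times_hend.rep_eq zero_hend.rep_eq)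
    have "Rep_hend f \<noteq> opzero" using \<open>f \<noteq> 0\<close> by (metis hend_eqI zero_hend.rep_eq)
    \<comment> \<open>Every value of \<open>g\<close> is killed by the nonzero \<open>f\<close>, so
      torsion-freeness of H makes it zero.\<close>
    have "Rep_hend g = opzero"
    proof (rule end_op_eqI[OF end_op_Rep end_op_opzero])
      fix \<phi> assume \<phi>: "\<phi> \<in> Hset"
      have "Rep_hend f (Rep_hend g \<phi>) = hzero"
        using fun_cong[OF fg, of \<phi>] \<phi> by (simp add: opmult_apply opzero_apply)
      then have "Rep_hend g \<phi> = hzero"
        using Malg_torsion_free[of "Rep_hend f" "Rep_hend g \<phi>"] f \<open>Rep_hend f \<noteq> opzero\<close>
          end_op_Hset[OF end_op_Rep \<phi>] by (simp add: M_hend_def)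
      then show "Rep_hend g \<phi> = opzero \<phi>" using \<phi> by (simp add: opzero_apply)
    qed
    then show False using \<open>g \<noteq> 0\<close> by (metis hend_eqI zero_hend.rep_eq)
  qed
next
  show "Abs_hend delta \<in> R_hend" by (simp add: R_hend_def Rep_Abs_hend end_op_delta Ralg.del)
  fix r s assume "r \<in> R_hend" "s \<in> R_hend"
  then show "r + s \<in> R_hend" "r * s \<in> R_hend"
    by (simp_all add: R_hend_def hend_rep_eq Ralg.add Ralg.mult)
next
  fix S assume S: "M_hend \<subseteq> S" "Abs_hend delta \<in> S" "\<And>r s. r \<in> S \<Longrightarrow> s \<in> S \<Longrightarrow> r + s \<in> S"
    "\<And>r s. r \<in> S \<Longrightarrow> s \<in> S \<Longrightarrow> r * s \<in> S"
  have M: "Abs_hend a \<in> S" if "a \<in> Malg" for a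
    using that S(1) by (auto simp: M_hend_def Rep_Abs_hend end_op_Malg)
  have "Abs_hend a \<in> S" if "a \<in> Ralg" for a
    using that
  proof (induction rule: Ralg.induct)
    case (add a b)
    have "Abs_hend (opadd a b) = Abs_hend a + Abs_hend b"
      by (rule hend_eqI) (simp add: hend_rep_eq Rep_Abs_hend end_op_opadd end_op_Ralg add)
    then show ?case using add S(3) by simp
  next
    case (mult a b)
    have "Abs_hend (opmult a b) = Abs_hend a * Abs_hend b"
      by (rule hend_eqI) (simp add: hend_rep_eq Rep_Abs_hend end_op_opmult end_op_Ralg mult)
    then show ?case using mult S(4) by simp
  qed (use S(2) M Malg.intros in auto)
  from this[of "Rep_hend _"] show "R_hend \<subseteq> S" by (auto simp: R_hend_def Rep_hend_inverse)
qed

lemma closure_ideal_iff: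
  assumes "a \<in> Ralg"
  shows "Rep_hend x \<in> closure_ideal a \<longleftrightarrow> x \<in> Rops.saturation (Abs_hend a)"
proof
  assume "Rep_hend x \<in> closure_ideal a"
  then obtain f r where h: "Rep_hend x \<in> Ralg" "f \<in> Malg" "f \<noteq> opzero" "r \<in> Ralg"
      "opmult f (Rep_hend x) = opmult r a"
    by (auto simp: closure_ideal_def Rmul_def)
  have "Abs_hend f * x = Abs_hend r * Abs_hend a"
    by (rule hend_eqI) (simp add: hend_rep_eq Rep_Abs_hend end_op_Malg end_op_Ralg h assms)
  moreover have "Abs_hend f \<noteq> 0"
    using h by (metis Rep_Abs_hend end_op_Malg zero_hend.rep_eq)
  ultimately show "x \<in> Rops.saturation (Abs_hend a)"
    using h by (intro Rops.saturationI[of _ "Abs_hend f" "Abs_hend r"])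
      (simp_all add: R_hend_def M_hend_def Rep_Abs_hend end_op_Malg end_op_Ralg)
next
  assume "x \<in> Rops.saturation (Abs_hend a)"
  then obtain f r where h: "x \<in> R_hend" "f \<in> M_hend" "f \<noteq> 0" "r \<in> R_hend" "f * x = r * Abs_hend a"
    by (auto simp: Rops.saturation_def)
  have "opmult (Rep_hend f) (Rep_hend x) = opmult (Rep_hend r) a"
    using arg_cong[OF h(5), of Rep_hend] by (simp add: hend_rep_eq Rep_Abs_hend end_op_Ralg assms)
  moreover have "Rep_hend f \<noteq> opzero"
    using h(3) by (metis hend_eqI zero_hend.rep_eq)
  ultimately show "Rep_hend x \<in> closure_ideal a"
    using h by (auto simp: closure_ideal_def Rmul_def R_hend_def M_hend_def)
qed

text \<open>The preimage under \<open>Rep_hend\<close> sees only those members of \<open>I\<close>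
  that are additive endomorphisms; the separate inclusion in \<open>Ralg\<close> controls the
  others.\<close>

lemma left_ideal_iff: "left_ideal I \<longleftrightarrow> I \<subseteq> Ralg \<and> Rops.lideal {x. Rep_hend x \<in> I}"
proof (intro iffI conjI; (elim conjE)?)
  assume I: "left_ideal I"
  then show "I \<subseteq> Ralg" by (simp add: left_ideal_def)
  from I show "Rops.lideal {x. Rep_hend x \<in> I}"
    unfolding Rops.lideal_def by (auto simp: left_ideal_def R_hend_def hend_rep_eq)
next
  assume I: "I \<subseteq> Ralg" "Rops.lideal {x. Rep_hend x \<in> I}"
  have rep: "Rep_hend (Abs_hend a) = a" if "a \<in> Ralg" for a
    using that by (simp add: Rep_Abs_hend end_op_Ralg)
  have "opzero \<in> I" using I(2) by (simp add: Rops.lideal_def hend_rep_eq)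
  moreover have "opadd a b \<in> I" if "a \<in> I" "b \<in> I" for a b
  proof -
    have "Rep_hend (Abs_hend a) = a" "Rep_hend (Abs_hend b) = b" using I(1) that rep by auto
    moreover from this have "Rep_hend (Abs_hend a + Abs_hend b) \<in> I"
      using I(2) that by (auto simp: Rops.lideal_def)
    ultimately show ?thesis by (simp add: hend_rep_eq)
  qed
  moreover have "opmult r a \<in> I" if "r \<in> Ralg" "a \<in> I" for r a
  proof -
    have "Rep_hend (Abs_hend a) = a" "Rep_hend (Abs_hend r) = r" using I(1) that rep by auto
    moreover from this have "Rep_hend (Abs_hend r * Abs_hend a) \<in> I"
      using Rops.lideal_R_mult[OF I(2), of "Abs_hend r" "Abs_hend a"] that by (simp add: R_hend_def)
    ultimately show ?thesis by (simp add: hend_rep_eq)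
  qed
  ultimately show "left_ideal I" using I(1) by (simp add: left_ideal_def)
qed

lemma left_ideal_closure_ideal:
  assumes "a \<in> Ralg"
  shows "left_ideal (closure_ideal a)"
proof -
  have "Abs_hend a \<in> R_hend" using assms by (simp add: R_hend_def Rep_Abs_hend end_op_Ralg)
  from Rops.lideal_saturation[OF this] show ?thesis
    by (simp add: left_ideal_iff closure_ideal_iff assms) (simp add: closure_ideal_def)
qed

lemma left_ideal_between:
  assumes "left_ideal I"
  shows "\<exists>a\<in>I. Rmul a \<subseteq> I \<and> I \<subseteq> closure_ideal a"
proof -
  have I: "I \<subseteq> Ralg" "Rops.lideal {x. Rep_hend x \<in> I}" using assms by (simp_all add: left_ideal_iff)
  obtain x where x: "Rep_hend x \<in> I" "{x. Rep_hend x \<in> I} \<subseteq> Rops.saturation x"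
    using Rops.lideal_between[OF I(2)] by auto
  have "b \<in> closure_ideal (Rep_hend x)" if "b \<in> I" for b
  proof -
    have b: "Rep_hend (Abs_hend b) = b" using that I(1) by (auto simp: Rep_Abs_hend end_op_Ralg)
    then have "Abs_hend b \<in> Rops.saturation x" using x(2) that by auto
    then show ?thesis
      using closure_ideal_iff[of "Rep_hend x" "Abs_hend b"] x(1) I(1) b by (auto simp: Rep_hend_inverse)
  qed
  moreover have "Rmul (Rep_hend x) \<subseteq> I"
    using assms x(1) by (auto simp: left_ideal_def Rmul_def)
  ultimately show ?thesis using x(1) by blast
qed

lemma end_op_hzero:
  assumes "end_op T"
  shows "T hzero = hzero"
proof -
  have "hplus hzero hzero = hzero" by (simp add: hplus_def hzero_def)
  then have "T hzero = hplus (T hzero) (T hzero)"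
    using end_op_hplus[OF assms Hset_hzero Hset_hzero] by simp
  then have "T hzero m z = T hzero m z + T hzero m z" for m z
    unfolding hplus_def by metis
  then show ?thesis by (simp add: fun_eq_iff hzero_def)
qed

lemma left_ideal_ann:
  assumes \<phi>: "\<phi> \<in> Hset"
  shows "left_ideal (ann \<phi>)"
  unfolding left_ideal_def
proof (intro conjI ballI)
  show "ann \<phi> \<subseteq> Ralg" by (auto simp: ann_def)
  show "opzero \<in> ann \<phi>" using \<phi> by (simp add: ann_def opzero_apply) (simp add: opzero_eq Ralg.scal)
  show "opadd a b \<in> ann \<phi>" if "a \<in> ann \<phi>" "b \<in> ann \<phi>" for a b
    using that \<phi> by (auto simp: ann_def Ralg.add opadd_apply hzero_def fun_eq_iff)
  show "opmult r a \<in> ann \<phi>" if "r \<in> Ralg" "a \<in> ann \<phi>" for r a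
    using that \<phi> by (auto simp: ann_def Ralg.mult opmult_apply end_op_hzero end_op_Ralg)
qed

text \<open>Choose \<open>a\<close> for the annihilator by the previous result on left ideals. If
  \<open>f b = r a\<close>, then \<open>f\<close> kills \<open>b \<phi>\<close>, and
  torsion-freeness puts \<open>b\<close> into the annihilator.\<close>

lemma ann_eq_closure_ideal:
  assumes \<phi>: "\<phi> \<in> Hset"
  shows "\<exists>a\<in>Ralg. ann \<phi> = closure_ideal a"
proof -
  obtain a where a: "a \<in> ann \<phi>" "ann \<phi> \<subseteq> closure_ideal a"
    using left_ideal_between[OF left_ideal_ann[OF \<phi>]] by blast
  have "b \<in> ann \<phi>" if b: "b \<in> closure_ideal a" for b
  proof -
    obtain f r where h: "b \<in> Ralg" "f \<in> Malg" "f \<noteq> opzero" "r \<in> Ralg" "opmult f b = opmult r a"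
      using b unfolding closure_ideal_def Rmul_def by blast
    have "f (b \<phi>) = r (a \<phi>)"
      using fun_cong[OF h(5), of \<phi>] \<phi> by (simp add: opmult_apply)
    also have "\<dots> = hzero" using a(1) h(4) by (simp add: ann_def end_op_hzero end_op_Ralg)
    finally have "b \<phi> = hzero"
      by (rule Malg_torsion_free[OF h(2,3) end_op_Hset[OF end_op_Ralg[OF h(1)] \<phi>]])
    then show ?thesis using h(1) by (simp add: ann_def)
  qed
  with a show ?thesis by (auto simp: ann_def)
qed

theorem theorem7p3:
  shows "(\<forall>a\<in>Ralg. left_ideal (closure_ideal a))
       \<and> (\<forall>I. left_ideal I \<longrightarrow> (\<exists>a\<in>I. Rmul a \<subseteq> I \<and> I \<subseteq> closure_ideal a))
       \<and> (\<forall>\<phi>\<in>Hset. \<exists>a\<in>Ralg. ann \<phi> = closure_ideal a)"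
  using left_ideal_closure_ideal left_ideal_between ann_eq_closure_ideal by blast

end
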